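(* Assume $\lim_{n\to\infty}X'X/n=Q$ exists and is positive definite, that $k_2=1$, and that $Q_{12}=0$. Then for every $\beta\in M_R$ and every $t\in\mathbb{R}^k$ there exist $\delta_0>0$ and $0<\rho_0<\infty$ (which may be chosen depending only on $t,Q,\sigma,\alpha$) such that: (i) every estimator $\hat F_n(t)$ satisfying $\mathbb{P}_{n,\beta,\sigma}(|\hat F_n(t)-F_{n,\beta,\sigma}(t)|>\delta)\to0$ for every $\delta>0$ also satisfies $$\sup_{\vartheta\in\mathbb{R}^k,\ \|\vartheta-\beta\|<\rho_0/\sqrt n}\mathbb{P}_{n,\vartheta,\sigma}\big(|\hat F_n(t)-F_{n,\vartheta,\sigma}(t)|>\delta_0\big)\to1\quad(n\to\infty);$$ (ii) $\liminf_{n\to\infty}\inf_{\hat F_n(t)}\sup_{\|\vartheta-\beta\|<\rho_0/\sqrt n}\mathbb{P}_{n,\vartheta,\sigma}(|\hat F_n(t)-F_{n,\vartheta,\sigma}(t)|>\delta_0)>0$; (iii) $\sup_{\delta>0}\liminf_{n\to\infty}\inf_{\hat F_n(t)}\sup_{\|\vartheta-\beta\|<\rho_0/\sqrt n}\mathbb{P}_{n,\vartheta,\sigma}(|\hat F_n(t)-F_{n,\vartheta,\sigma}(t)|>\delta)\ge\tfrac12$, where the infima range over all estimators $\hat F_n(t)$.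
   Context: Setup: for each sample size $n$, $Y=X\beta+u$, $X$ a non-stochastic $n\times k$ matrix of full column rank $k$ (so $n\ge k$), $k>1$, $u\sim N(0,\sigma^2I_n)$, $\sigma^2>0$ known; $\mathbb{P}_{n,\beta,\sigma}$ is the distribution of $Y$ on $\mathbb{R}^n$. Partition $X=[X_1:X_2]$, $\beta=(\beta_1',\beta_2')'$, $X_i$ having $k_i\ge1$ columns; $Q$ partitioned conformably into $Q_{11},Q_{12},Q_{21},Q_{22}$. $M_R=\{\beta\in\mathbb{R}^k:\beta_2=0\}$. $\hat\beta(R)=\big(((X_1'X_1)^{-1}X_1'Y)',0\big)'$, $\hat\beta(U)=(X'X)^{-1}X'Y$, $\tilde\beta=\hat\lambda\hat\beta(R)+(1-\hat\lambda)\hat\beta(U)$, $\hat\lambda=[1+\exp(-2\alpha k_2)\exp(\alpha\|X\hat\beta(R)-X\hat\beta(U)\|^2/\sigma^2)]^{-1}$, $\alpha>0$. $F_{n,\beta,\sigma}(t)=\mathbb{P}_{n,\beta,\sigma}(\sqrt n(\tilde\beta-\beta)\le t)$, componentwise inequality. An estimator $\hat F_n(t)$ of $F_{n,\beta,\sigma}(t)$ is any real-valued measurable function of $Y$ (and the known $X$), not necessarily taking values in $[0,1]$. *)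

theory Defs
  imports "HOL-Probability.Probability" "Jordan_Normal_Form.Matrix" "Jordan_Normal_Form.Gauss_Jordan_Elimination" "Jordan_Normal_Form.DL_Rank"
begin

text \<open>Linear regression Y = X beta + u, u ~ N(0, sigma^2 I_n). For each sample size n the design
  is an n x k real matrix X n; the first k1 columns form X1, the remaining k2 = k - k1 columns X2.
  Observations Y are elements of R^n, represented as functions nat => real (coordinates i < n)
  living in the product space PiM {..<n}.\<close>

definition pos_def_mat :: "real mat \<Rightarrow> bool" where
  "pos_def_mat A \<longleftrightarrow> square_mat A \<and> transpose_mat A = A \<and>
     (\<forall>v \<in> carrier_vec (dim_row A). v \<noteq> 0\<^sub>v (dim_row A) \<longrightarrow> v \<bullet> (A *\<^sub>v v) > 0)"

definition design_seq :: "nat \<Rightarrow> (nat \<Rightarrow> real mat) \<Rightarrow> bool" where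
  "design_seq k X \<longleftrightarrow> (\<forall>n. X n \<in> carrier_mat n k) \<and>
     (\<forall>n\<ge>k. vec_space.rank n (X n :: real mat) = k)"

definition obs_space :: "nat \<Rightarrow> (nat \<Rightarrow> real) measure" where
  "obs_space n = PiM {..<n} (\<lambda>_. lborel)"

definition distrY :: "(nat \<Rightarrow> real mat) \<Rightarrow> real \<Rightarrow> nat \<Rightarrow> real vec \<Rightarrow> (nat \<Rightarrow> real) measure" where
  "distrY X \<sigma> n b = PiM {..<n} (\<lambda>i. density lborel (normal_density ((X n *\<^sub>v b) $ i) \<sigma>))"

definition mat_inv :: "real mat \<Rightarrow> real mat" where
  "mat_inv A = the (mat_inverse A)"

definition X1_of :: "(nat \<Rightarrow> real mat) \<Rightarrow> nat \<Rightarrow> nat \<Rightarrow> real mat" where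
  "X1_of X k1 n = mat (dim_row (X n)) k1 (\<lambda>(i, j). X n $$ (i, j))"

definition betaU :: "(nat \<Rightarrow> real mat) \<Rightarrow> nat \<Rightarrow> (nat \<Rightarrow> real) \<Rightarrow> real vec" where
  "betaU X n Y = mat_inv (transpose_mat (X n) * X n) *\<^sub>v (transpose_mat (X n) *\<^sub>v vec n Y)"

definition betaR :: "(nat \<Rightarrow> real mat) \<Rightarrow> nat \<Rightarrow> nat \<Rightarrow> nat \<Rightarrow> (nat \<Rightarrow> real) \<Rightarrow> real vec" where
  "betaR X k k1 n Y = (let X1 = X1_of X k1 n;
       b1 = mat_inv (transpose_mat X1 * X1) *\<^sub>v (transpose_mat X1 *\<^sub>v vec n Y)
     in vec k (\<lambda>j. if j < k1 then b1 $ j else 0))"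

definition sqnorm :: "real vec \<Rightarrow> real" where
  "sqnorm v = v \<bullet> v"

definition lambda_hat :: "(nat \<Rightarrow> real mat) \<Rightarrow> nat \<Rightarrow> nat \<Rightarrow> real \<Rightarrow> real \<Rightarrow> nat \<Rightarrow> (nat \<Rightarrow> real) \<Rightarrow> real" where
  "lambda_hat X k k1 \<sigma> \<alpha> n Y =
     inverse (1 + exp (- 2 * \<alpha> * real (k - k1)) *
       exp (\<alpha> * sqnorm (X n *\<^sub>v betaR X k k1 n Y - X n *\<^sub>v betaU X n Y) / \<sigma>\<^sup>2))"

definition beta_tilde :: "(nat \<Rightarrow> real mat) \<Rightarrow> nat \<Rightarrow> nat \<Rightarrow> real \<Rightarrow> real \<Rightarrow> nat \<Rightarrow> (nat \<Rightarrow> real) \<Rightarrow> real vec" where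
  "beta_tilde X k k1 \<sigma> \<alpha> n Y =
     lambda_hat X k k1 \<sigma> \<alpha> n Y \<cdot>\<^sub>v betaR X k k1 n Y
     + (1 - lambda_hat X k k1 \<sigma> \<alpha> n Y) \<cdot>\<^sub>v betaU X n Y"

definition Fdist :: "(nat \<Rightarrow> real mat) \<Rightarrow> nat \<Rightarrow> nat \<Rightarrow> real \<Rightarrow> real \<Rightarrow> real vec \<Rightarrow> nat \<Rightarrow> real vec \<Rightarrow> real" where
  "Fdist X k k1 \<sigma> \<alpha> t n b =
     measure (distrY X \<sigma> n b)
       {Y \<in> space (distrY X \<sigma> n b). \<forall>j<k. sqrt (real n) * (beta_tilde X k k1 \<sigma> \<alpha> n Y $ j - b $ j) \<le> t $ j}"

definition estimators :: "nat \<Rightarrow> ((nat \<Rightarrow> real) \<Rightarrow> real) set" where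
  "estimators n = borel_measurable (obs_space n)"

definition err_prob :: "(nat \<Rightarrow> real mat) \<Rightarrow> nat \<Rightarrow> nat \<Rightarrow> real \<Rightarrow> real \<Rightarrow> real vec \<Rightarrow> nat \<Rightarrow> real vec
     \<Rightarrow> ((nat \<Rightarrow> real) \<Rightarrow> real) \<Rightarrow> real \<Rightarrow> real" where
  "err_prob X k k1 \<sigma> \<alpha> t n \<theta> g \<delta> =
     measure (distrY X \<sigma> n \<theta>)
       {Y \<in> space (distrY X \<sigma> n \<theta>). \<bar>g Y - Fdist X k k1 \<sigma> \<alpha> t n \<theta>\<bar> > \<delta>}"

definition nbhd :: "nat \<Rightarrow> real vec \<Rightarrow> real \<Rightarrow> nat \<Rightarrow> real vec set" where
  "nbhd k \<beta> \<rho> n = {\<theta> \<in> carrier_vec k. sqrt (sqnorm (\<theta> - \<beta>)) < \<rho> / sqrt (real n)}"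

end

theory Submission
  imports Defs
begin

text \<open>
  Work in the local coordinates \<open>\<theta> = \<beta> + (g / sqrt n) e\<^sub>k\<close>. With \<open>H\<close> the inverse of \<open>X'X\<close>, the
  restricted estimator is \<open>betaU - (H e\<^sub>k / H\<^sub>k\<^sub>k) betaU\<^sub>k\<close>, so up to corrections of order
  \<open>H\<^sub>j\<^sub>k / H\<^sub>k\<^sub>k\<close>, which vanish because \<open>Q\<^sub>1\<^sub>2 = 0\<close>, only the last coordinate is affected by model
  averaging, through the strictly increasing map \<open>shrink\<close>. Hence the distribution function at \<open>t\<close> is
  asymptotically the Gaussian probability of \<open>U\<^sub>j \<le> t\<^sub>j\<close> for \<open>j < k\<close> and \<open>U\<^sub>k \<le> local_cut g\<close>, and
  \<open>local_cut\<close> is not constant in \<open>g\<close>.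

  On the other hand, the laws of \<open>Y\<close> under two local parameters have bounded chi-square distance,
  which tends to 0 with the distance of the parameters. An estimator that is accurate under one
  parameter is therefore inaccurate under the other one. Taking two neighbouring points of a fine
  grid between \<open>0\<close> and \<open>g\<close> with different values of \<open>local_cut\<close> gives the constant \<open>1/2\<close>.
\<close>

section \<open>Product Gaussian measures\<close>

text \<open>The constants must be fixed before the design and \<beta>, so no limit law of the
  estimator is derived. What is needed is a gap between the distribution functions at two local
  parameters, bounded below by a number computed from t, Q, \<sigma> and \<alpha>. The gap comes
  from the event that the first coordinates obey their bounds while the last one lies in a window
  between the two cuts. These coordinates are correlated, so its probability has no product form; a
  change of mean replaces an estimate of the joint density. The change of measure has the shape
  P'(A) \<le> P(A) + T sqrt(P(A)), T being the root of the chi-square distance, and serves all three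
  claims. If P(A) tends to 0, any bounded T sends P'(A) to 0. If T is merely bounded, two errors
  cannot both be small. If T is near 0, they sum to nearly 1, whence 1/2. The last case needs
  neighbouring parameters whose gap may be tiny, which is harmless because the third claim takes a
  supremum over \<delta>.\<close>

definition gauss :: "real \<Rightarrow> nat \<Rightarrow> (nat \<Rightarrow> real) \<Rightarrow> (nat \<Rightarrow> real) measure" where
  "gauss \<sigma> n \<mu> = PiM {..<n} (\<lambda>i. density lborel (normal_density (\<mu> i) \<sigma>))"

lemma distrY_eq_gauss: "distrY X \<sigma> n b = gauss \<sigma> n (\<lambda>i. (X n *\<^sub>v b) $ i)"
  by (simp add: distrY_def gauss_def)

lemma sets_gauss [measurable_cong]: "sets (gauss \<sigma> n \<mu>) = sets (PiM {..<n} (\<lambda>_. borel))"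
  unfolding gauss_def by (rule sets_PiM_cong) auto

lemma space_gauss: "space (gauss \<sigma> n \<mu>) = PiE {..<n} (\<lambda>_. UNIV)"
  by (simp add: gauss_def space_PiM)

lemma prob_space_gauss: "0 < \<sigma> \<Longrightarrow> prob_space (gauss \<sigma> n \<mu>)"
  unfolding gauss_def by (intro prob_space_PiM prob_space_normal_density)

section \<open>Densities and the chi-square comparison of two Gaussian laws\<close>

definition gauss_dens :: "real \<Rightarrow> nat \<Rightarrow> (nat \<Rightarrow> real) \<Rightarrow> (nat \<Rightarrow> real) \<Rightarrow> real" where
  "gauss_dens \<sigma> n \<mu> y = (\<Prod>i<n. normal_density (\<mu> i) \<sigma> (y i))"

lemma gauss_dens_pos: "0 < \<sigma> \<Longrightarrow> 0 < gauss_dens \<sigma> n \<mu> y"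
  unfolding gauss_dens_def by (intro prod_pos) (auto simp: normal_density_pos)

lemma gauss_dens_measurable [measurable]:
  "gauss_dens \<sigma> n \<mu> \<in> borel_measurable (PiM {..<n} (\<lambda>_. borel))"
  unfolding gauss_dens_def[abs_def] by measurable

text \<open>Both measures agree on rectangles, where the integral of the product density factorises
  into one-dimensional integrals.\<close>

lemma gauss_density:
  assumes "0 < \<sigma>"
  shows "gauss \<sigma> n \<mu> = density (PiM {..<n} (\<lambda>_. lborel)) (\<lambda>y. ennreal (gauss_dens \<sigma> n \<mu> y))"
proof -
  interpret L: product_sigma_finite "\<lambda>_::nat. lborel :: real measure"
    by (rule product_sigma_finite.intro) (rule sigma_finite_lborel)
  interpret N: product_sigma_finite "\<lambda>i::nat. density lborel (normal_density (\<mu> i) \<sigma>)"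
    by (rule product_sigma_finite.intro)
       (rule prob_space_imp_sigma_finite[OF prob_space_normal_density[OF assms]])
  have "density (PiM {..<n} (\<lambda>_. lborel)) (\<lambda>y. ennreal (gauss_dens \<sigma> n \<mu> y))
      = PiM {..<n} (\<lambda>i. density lborel (normal_density (\<mu> i) \<sigma>))"
  proof (rule N.PiM_eqI)
    show "sets (density (PiM {..<n} (\<lambda>_. lborel)) (\<lambda>y. ennreal (gauss_dens \<sigma> n \<mu> y)))
      = sets (PiM {..<n} (\<lambda>i. density lborel (normal_density (\<mu> i) \<sigma>)))"
      by (simp, rule sets_PiM_cong) auto
  next
    fix A :: "nat \<Rightarrow> real set"
    assume A: "\<And>i. i \<in> {..<n} \<Longrightarrow> A i \<in> sets (density lborel (normal_density (\<mu> i) \<sigma>))"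
    have PA: "Pi\<^sub>E {..<n} A \<in> sets (PiM {..<n} (\<lambda>_. lborel))"
      using A by (intro sets_PiM_I_finite) auto
    have "emeasure (density (PiM {..<n} (\<lambda>_. lborel)) (\<lambda>y. ennreal (gauss_dens \<sigma> n \<mu> y))) (Pi\<^sub>E {..<n} A)
      = (\<integral>\<^sup>+y. ennreal (gauss_dens \<sigma> n \<mu> y) * indicator (Pi\<^sub>E {..<n} A) y \<partial>PiM {..<n} (\<lambda>_. lborel))"
      using PA by (intro emeasure_density) auto
    also have "\<dots> = (\<integral>\<^sup>+y. (\<Prod>i<n. ennreal (normal_density (\<mu> i) \<sigma> (y i)) * indicator (A i) (y i)) \<partial>PiM {..<n} (\<lambda>_. lborel))"
    proof (rule nn_integral_cong)
      fix y :: "nat \<Rightarrow> real" assume "y \<in> space (PiM {..<n} (\<lambda>_. lborel))"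
      then have "(indicator (Pi\<^sub>E {..<n} A) y :: ennreal) = (\<Prod>i<n. indicator (A i) (y i))"
        by (auto simp: indicator_def space_PiM PiE_def Pi_iff intro!: prod.neutral)
      then show "ennreal (gauss_dens \<sigma> n \<mu> y) * indicator (Pi\<^sub>E {..<n} A) y
        = (\<Prod>i<n. ennreal (normal_density (\<mu> i) \<sigma> (y i)) * indicator (A i) (y i))"
        by (simp add: gauss_dens_def prod.distrib prod_ennreal normal_density_nonneg)
    qed
    also have "\<dots> = (\<Prod>i<n. \<integral>\<^sup>+x. ennreal (normal_density (\<mu> i) \<sigma> x) * indicator (A i) x \<partial>lborel)"
      using A by (intro L.product_nn_integral_prod) auto
    also have "\<dots> = (\<Prod>i<n. emeasure (density lborel (normal_density (\<mu> i) \<sigma>)) (A i))"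
      using A by (intro prod.cong refl) (simp add: emeasure_density)
    finally show "emeasure (density (PiM {..<n} (\<lambda>_. lborel)) (\<lambda>y. ennreal (gauss_dens \<sigma> n \<mu> y))) (Pi\<^sub>E {..<n} A)
      = (\<Prod>i<n. emeasure (density lborel (normal_density (\<mu> i) \<sigma>)) (A i))" .
  qed simp
  then show ?thesis by (simp add: gauss_def)
qed

lemma gauss_dens_integral:
  assumes "0 < \<sigma>"
  shows "has_bochner_integral (PiM {..<n} (\<lambda>_. lborel)) (gauss_dens \<sigma> n \<mu>) 1"
proof -
  interpret prob_space "gauss \<sigma> n \<mu>" by (rule prob_space_gauss[OF assms])
  have "(\<integral>\<^sup>+y. ennreal (gauss_dens \<sigma> n \<mu> y) \<partial>PiM {..<n} (\<lambda>_. lborel)) = 1"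
    using emeasure_space_1 by (simp add: gauss_density[OF assms] emeasure_density cong: nn_integral_cong)
  then show ?thesis
    by (intro has_bochner_integral_nn_integral)
       (auto simp: less_imp_le[OF gauss_dens_pos[OF assms]])
qed

text \<open>The square of one normal density divided by another is a multiple of a third one, so
  the second moment of the likelihood ratio needs no integration.\<close>

lemma normal_density_sq_div:
  assumes "0 < \<sigma>"
  shows "(normal_density \<nu> \<sigma> x)\<^sup>2 / normal_density \<mu> \<sigma> x
    = exp ((\<nu> - \<mu>)\<^sup>2 / \<sigma>\<^sup>2) * normal_density (2 * \<nu> - \<mu>) \<sigma> x"
proof -
  define c where "c = sqrt (2 * pi * \<sigma>\<^sup>2)"
  have c: "c > 0" using assms by (simp add: c_def)
  define u where "u = exp (- (x - \<nu>)\<^sup>2 / (2 * \<sigma>\<^sup>2))"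
  define v where "v = exp (- (x - \<mu>)\<^sup>2 / (2 * \<sigma>\<^sup>2))"
  have "- (x - \<nu>)\<^sup>2 / (2 * \<sigma>\<^sup>2) + - (x - \<nu>)\<^sup>2 / (2 * \<sigma>\<^sup>2) - - (x - \<mu>)\<^sup>2 / (2 * \<sigma>\<^sup>2)
    = (\<nu> - \<mu>)\<^sup>2 / \<sigma>\<^sup>2 + - (x - (2 * \<nu> - \<mu>))\<^sup>2 / (2 * \<sigma>\<^sup>2)"
    using assms by (simp add: field_simps power2_eq_square)
  then have 1: "u * u / v = exp ((\<nu> - \<mu>)\<^sup>2 / \<sigma>\<^sup>2) * exp (- (x - (2 * \<nu> - \<mu>))\<^sup>2 / (2 * \<sigma>\<^sup>2))"
    unfolding u_def v_def exp_add[symmetric] exp_diff[symmetric] by (simp only:)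
  have "(1 / c * u)\<^sup>2 / (1 / c * v) = 1 / c * (u * u / v)"
    using c by (simp add: power2_eq_square)
  also have "\<dots> = exp ((\<nu> - \<mu>)\<^sup>2 / \<sigma>\<^sup>2) * (1 / c * exp (- (x - (2 * \<nu> - \<mu>))\<^sup>2 / (2 * \<sigma>\<^sup>2)))"
    unfolding 1 by (rule mult.left_commute)
  finally show ?thesis
    unfolding normal_density_def c_def u_def v_def .
qed

lemma gauss_dens_sq_div:
  assumes "0 < \<sigma>"
  shows "(gauss_dens \<sigma> n \<nu> y)\<^sup>2 / gauss_dens \<sigma> n \<mu> y
    = exp ((\<Sum>i<n. (\<nu> i - \<mu> i)\<^sup>2) / \<sigma>\<^sup>2) * gauss_dens \<sigma> n (\<lambda>i. 2 * \<nu> i - \<mu> i) y"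
proof -
  have "(gauss_dens \<sigma> n \<nu> y)\<^sup>2 / gauss_dens \<sigma> n \<mu> y
      = (\<Prod>i<n. (normal_density (\<nu> i) \<sigma> (y i))\<^sup>2 / normal_density (\<mu> i) \<sigma> (y i))"
    unfolding gauss_dens_def prod_dividef prod_power_distrib ..
  also have "\<dots> = (\<Prod>i<n. exp ((\<nu> i - \<mu> i)\<^sup>2 / \<sigma>\<^sup>2)) * (\<Prod>i<n. normal_density (2 * \<nu> i - \<mu> i) \<sigma> (y i))"
    unfolding normal_density_sq_div[OF assms] prod.distrib ..
  finally show ?thesis
    by (simp only: gauss_dens_def sum_divide_distrib exp_sum[OF finite_lessThan])
qed

text \<open>Cauchy-Schwarz on A for |g - f| written as |g - f| / sqrt f times sqrt f. As the error
  carries the root of the probability under \<mu>, the bound is informative even for a large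
  chi-square distance: sets that are rare under \<mu> stay rare under \<nu>.\<close>

lemma gauss_chi_square:
  assumes s: "0 < \<sigma>" and A: "A \<in> sets (gauss \<sigma> n \<mu>)"
  shows "measure (gauss \<sigma> n \<nu>) A \<le> measure (gauss \<sigma> n \<mu>) A
     + sqrt (exp ((\<Sum>i<n. (\<nu> i - \<mu> i)\<^sup>2) / \<sigma>\<^sup>2) - 1) * sqrt (measure (gauss \<sigma> n \<mu>) A)"
proof -
  define L where "L = PiM {..<n} (\<lambda>_. lborel :: real measure)"
  define f where "f = gauss_dens \<sigma> n \<mu>"
  define g where "g = gauss_dens \<sigma> n \<nu>"
  define E where "E = exp ((\<Sum>i<n. (\<nu> i - \<mu> i)\<^sup>2) / \<sigma>\<^sup>2) - 1"
  have E0: "0 \<le> E" unfolding E_def using s by (simp add: sum_nonneg)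
  have setsL: "sets L = sets (PiM {..<n} (\<lambda>_. borel))" unfolding L_def by (rule sets_PiM_cong) auto
  note [measurable_cong] = setsL
  have [measurable]: "A \<in> sets L" using A by (simp add: sets_gauss setsL)
  have [measurable]: "f \<in> borel_measurable L" "g \<in> borel_measurable L" unfolding f_def g_def by measurable
  have fpos: "f y > 0" and gpos: "g y > 0" for y
    unfolding f_def g_def using s by (auto intro: gauss_dens_pos)
  have mes: "ennreal (measure (gauss \<sigma> n \<kappa>) A) = (\<integral>\<^sup>+y. ennreal (gauss_dens \<sigma> n \<kappa> y) * indicator A y \<partial>L)" for \<kappa>
  proof -
    interpret prob_space "gauss \<sigma> n \<kappa>" by (rule prob_space_gauss[OF s])
    show ?thesis
      unfolding emeasure_eq_measure[symmetric] unfolding gauss_density[OF s] L_def[symmetric]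
      using A by (subst emeasure_density) (auto simp: setsL sets_gauss measurable_cong_sets[OF setsL refl])
  qed
  define d where "d = (\<lambda>y. \<bar>g y - f y\<bar>)"
  have [measurable]: "d \<in> borel_measurable L" unfolding d_def by measurable
  define P where "P = measure (gauss \<sigma> n \<mu>) A"
  have P: "ennreal P = (\<integral>\<^sup>+y. ennreal (f y) * indicator A y \<partial>L)" unfolding P_def f_def by (rule mes)
  define I where "I = (\<integral>\<^sup>+y. ennreal (d y) * indicator A y \<partial>L)"
  \<comment> \<open>Here (g - f)^2 / f = g^2 / f - 2 g + f, and every term is a multiple of a
    Gaussian density, so the integral is (E + 1) - 2 + 1.\<close>
  have int: "has_bochner_integral L (\<lambda>y. (d y)\<^sup>2 / f y) E"
  proof -
    have "(d y)\<^sup>2 / f y = exp ((\<Sum>i<n. (\<nu> i - \<mu> i)\<^sup>2) / \<sigma>\<^sup>2) * gauss_dens \<sigma> n (\<lambda>i. 2 * \<nu> i - \<mu> i) y - 2 * g y + f y" for y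
      unfolding gauss_dens_sq_div[OF s, symmetric] d_def f_def[symmetric] g_def[symmetric]
      using fpos[of y] by (simp add: field_simps power2_eq_square)
    moreover have "has_bochner_integral L (\<lambda>y. exp ((\<Sum>i<n. (\<nu> i - \<mu> i)\<^sup>2) / \<sigma>\<^sup>2) * gauss_dens \<sigma> n (\<lambda>i. 2 * \<nu> i - \<mu> i) y - 2 * g y + f y)
       (exp ((\<Sum>i<n. (\<nu> i - \<mu> i)\<^sup>2) / \<sigma>\<^sup>2) * 1 - 2 * 1 + 1)"
      unfolding L_def f_def g_def
      by (intro has_bochner_integral_add has_bochner_integral_diff has_bochner_integral_mult_right gauss_dens_integral s)
    ultimately show ?thesis by (simp add: E_def)
  qed
  have "I = (\<integral>\<^sup>+y. ennreal (d y / sqrt (f y)) * (ennreal (sqrt (f y)) * indicator A y) \<partial>L)"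
    unfolding I_def
  proof (rule nn_integral_cong)
    fix y
    have "ennreal (d y / sqrt (f y)) * ennreal (sqrt (f y)) = ennreal (d y)"
      using fpos[of y] by (subst ennreal_mult[symmetric]) (auto simp: d_def)
    then show "ennreal (d y) * indicator A y = ennreal (d y / sqrt (f y)) * (ennreal (sqrt (f y)) * indicator A y)"
      by (simp add: mult.assoc[symmetric])
  qed
  then have "I\<^sup>2 \<le> (\<integral>\<^sup>+y. (ennreal (d y / sqrt (f y)))\<^sup>2 \<partial>L) * (\<integral>\<^sup>+y. (ennreal (sqrt (f y)) * indicator A y)\<^sup>2 \<partial>L)"
    by (simp only:) (rule Cauchy_Schwarz_nn_integral; measurable)
  also have "(\<integral>\<^sup>+y. (ennreal (d y / sqrt (f y)))\<^sup>2 \<partial>L) = (\<integral>\<^sup>+y. ennreal ((d y)\<^sup>2 / f y) \<partial>L)"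
    by (intro nn_integral_cong) (simp add: ennreal_power fpos less_imp_le d_def power_divide)
  also have "\<dots> = ennreal E"
    using int nn_integral_eq_integral[of L "\<lambda>y. (d y)\<^sup>2 / f y"]
    by (auto simp: has_bochner_integral_iff less_imp_le[OF fpos])
  also have "(\<integral>\<^sup>+y. (ennreal (sqrt (f y)) * indicator A y)\<^sup>2 \<partial>L) = ennreal P"
    unfolding P
    by (intro nn_integral_cong) (simp add: ennreal_power fpos less_imp_le power_mult_distrib indicator_def)
  also have "ennreal E * ennreal P = ennreal ((sqrt E * sqrt P)\<^sup>2)"
    using E0 by (simp add: ennreal_mult power_mult_distrib P_def)
  finally have I2: "I\<^sup>2 \<le> ennreal ((sqrt E * sqrt P)\<^sup>2)" .
  have Itop: "I \<noteq> \<infinity>"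
  proof
    assume "I = \<infinity>" then show False using I2 by (simp add: ennreal_top_mult power2_eq_square top_unique)
  qed
  then obtain r where r: "I = ennreal r" "0 \<le> r" by (cases I) auto
  have "r\<^sup>2 \<le> (sqrt E * sqrt P)\<^sup>2"
    using I2 r by (simp add: ennreal_power del: power_mult_distrib)
  then have rle: "r \<le> sqrt E * sqrt P"
    by (rule power2_le_imp_le) (use E0 in \<open>simp add: P_def\<close>)
  have "ennreal (measure (gauss \<sigma> n \<nu>) A) = (\<integral>\<^sup>+y. ennreal (g y) * indicator A y \<partial>L)"
    unfolding g_def by (rule mes)
  also have "\<dots> \<le> (\<integral>\<^sup>+y. ennreal (f y) * indicator A y + ennreal (d y) * indicator A y \<partial>L)"
    using fpos by (intro nn_integral_mono)
       (auto simp: d_def indicator_def ennreal_plus[symmetric] less_imp_le simp del: ennreal_plus)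
  also have "\<dots> = ennreal P + I"
    unfolding P I_def by (rule nn_integral_add) measurable
  also have "\<dots> = ennreal (P + r)" using r by (simp add: P_def)
  finally have "ennreal (measure (gauss \<sigma> n \<nu>) A) \<le> ennreal (P + r)" .
  moreover have "0 \<le> P + r" using r by (simp add: P_def)
  ultimately have "measure (gauss \<sigma> n \<nu>) A \<le> P + r" by (simp only: ennreal_le_iff)
  then show ?thesis using rle unfolding P_def E_def by linarith
qed

section \<open>Translations of Gaussian laws\<close>

lemma gauss_translate:
  assumes s: "0 < \<sigma>"
  shows "gauss \<sigma> n (\<lambda>i. \<nu> i + \<mu> i)
    = distr (gauss \<sigma> n \<nu>) (PiM {..<n} (\<lambda>_. borel)) (\<lambda>y. \<lambda>i\<in>{..<n}. y i + \<mu> i)"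
proof -
  interpret N: product_sigma_finite "\<lambda>i::nat. density lborel (normal_density (\<nu> i) \<sigma>)"
    by (rule product_sigma_finite.intro)
       (rule prob_space_imp_sigma_finite[OF prob_space_normal_density[OF s]])
  interpret N': product_sigma_finite "\<lambda>i::nat. density lborel (normal_density (\<nu> i + \<mu> i) \<sigma>)"
    by (rule product_sigma_finite.intro)
       (rule prob_space_imp_sigma_finite[OF prob_space_normal_density[OF s]])
  have [measurable]: "(\<lambda>y. \<lambda>i\<in>{..<n}. y i + \<mu> i) \<in> gauss \<sigma> n \<nu> \<rightarrow>\<^sub>M PiM {..<n} (\<lambda>_. borel)"
    by measurable
  have shift: "distr (density lborel (normal_density (\<nu> i) \<sigma>)) borel (\<lambda>x. x + \<mu> i)
      = density lborel (normal_density (\<nu> i + \<mu> i) \<sigma>)" for i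
  proof -
    have "distributed (density lborel (normal_density (\<nu> i) \<sigma>)) lborel (\<lambda>x. x) (normal_density (\<nu> i) \<sigma>)"
      by (auto simp: distributed_def intro!: distr_id2)
    from prob_space.normal_density_affine[OF prob_space_normal_density[OF s] this s, of 1 "\<mu> i"]
    have "distributed (density lborel (normal_density (\<nu> i) \<sigma>)) lborel (\<lambda>x. x + \<mu> i) (normal_density (\<nu> i + \<mu> i) \<sigma>)"
      by (simp add: add.commute)
    then show ?thesis unfolding distributed_def
      by (metis distr_cong sets_lborel)
  qed
  have "distr (gauss \<sigma> n \<nu>) (PiM {..<n} (\<lambda>_. borel)) (\<lambda>y. \<lambda>i\<in>{..<n}. y i + \<mu> i)
     = PiM {..<n} (\<lambda>i. density lborel (normal_density (\<nu> i + \<mu> i) \<sigma>))"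
  proof (rule N'.PiM_eqI)
    show "sets (distr (gauss \<sigma> n \<nu>) (PiM {..<n} (\<lambda>_. borel)) (\<lambda>y. \<lambda>i\<in>{..<n}. y i + \<mu> i))
       = sets (PiM {..<n} (\<lambda>i. density lborel (normal_density (\<nu> i + \<mu> i) \<sigma>)))"
      by (simp, rule sets_PiM_cong) auto
  next
    fix A :: "nat \<Rightarrow> real set"
    assume A: "\<And>i. i \<in> {..<n} \<Longrightarrow> A i \<in> sets (density lborel (normal_density (\<nu> i + \<mu> i) \<sigma>))"
    \<comment> \<open>Restricting to \<open>{..<n}\<close> keeps the image extensional, so the
      preimage of a box is again a box.\<close>
    have pre: "(\<lambda>y. \<lambda>i\<in>{..<n}. y i + \<mu> i) -` Pi\<^sub>E {..<n} A \<inter> space (gauss \<sigma> n \<nu>)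
        = Pi\<^sub>E {..<n} (\<lambda>i. (\<lambda>x. x + \<mu> i) -` A i)"
      by (auto simp: space_gauss PiE_iff extensional_def)
    have "emeasure (distr (gauss \<sigma> n \<nu>) (PiM {..<n} (\<lambda>_. borel)) (\<lambda>y. \<lambda>i\<in>{..<n}. y i + \<mu> i)) (Pi\<^sub>E {..<n} A)
      = emeasure (gauss \<sigma> n \<nu>) (Pi\<^sub>E {..<n} (\<lambda>i. (\<lambda>x. x + \<mu> i) -` A i))"
      using A by (subst emeasure_distr) (auto simp: pre intro!: sets_PiM_I_finite)
    also have "\<dots> = (\<Prod>i<n. emeasure (density lborel (normal_density (\<nu> i) \<sigma>)) ((\<lambda>x. x + \<mu> i) -` A i))"
      unfolding gauss_def using A
      by (intro N.emeasure_PiM) (auto intro!: measurable_sets_borel[of "\<lambda>x. x + \<mu> _" borel])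
    also have "\<dots> = (\<Prod>i<n. emeasure (density lborel (normal_density (\<nu> i + \<mu> i) \<sigma>)) (A i))"
    proof (rule prod.cong[OF refl])
      fix i assume "i \<in> {..<n}"
      then have "A i \<in> sets borel" using A by auto
      then show "emeasure (density lborel (normal_density (\<nu> i) \<sigma>)) ((\<lambda>x. x + \<mu> i) -` A i)
          = emeasure (density lborel (normal_density (\<nu> i + \<mu> i) \<sigma>)) (A i)"
        unfolding shift[symmetric] by (subst emeasure_distr) auto
    qed
    finally show "emeasure (distr (gauss \<sigma> n \<nu>) (PiM {..<n} (\<lambda>_. borel)) (\<lambda>y. \<lambda>i\<in>{..<n}. y i + \<mu> i)) (Pi\<^sub>E {..<n} A)
      = (\<Prod>i<n. emeasure (density lborel (normal_density (\<nu> i + \<mu> i) \<sigma>)) (A i))" .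
  qed simp
  then show ?thesis by (simp only: gauss_def[of \<sigma> n "\<lambda>i. \<nu> i + \<mu> i"])
qed

text \<open>Brings the law with any mean back to the noise law, so that events under different
  parameters are compared under one measure.\<close>

lemma measure_gauss_translate:
  assumes s: "0 < \<sigma>" and A: "A \<in> sets (PiM {..<n} (\<lambda>_. borel))"
  shows "measure (gauss \<sigma> n \<mu>) A
    = measure (gauss \<sigma> n (\<lambda>_. 0)) {y \<in> space (gauss \<sigma> n (\<lambda>_. 0)). (\<lambda>i\<in>{..<n}. y i + \<mu> i) \<in> A}"
proof -
  have "gauss \<sigma> n \<mu> = distr (gauss \<sigma> n (\<lambda>_. 0)) (PiM {..<n} (\<lambda>_. borel)) (\<lambda>y. \<lambda>i\<in>{..<n}. y i + \<mu> i)"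
    using gauss_translate[OF s, of n "\<lambda>_. 0" \<mu>] by simp
  then show ?thesis
    using A by (simp add: measure_distr vimage_def Int_def conj_commute)
qed

section \<open>Linear statistics of the noise: law, small intervals, windows and tails\<close>

lemma gauss_linear_distributed:
  assumes s: "0 < \<sigma>" and a: "0 < (\<Sum>i<n. (a i)\<^sup>2)"
  shows "distributed (gauss \<sigma> n (\<lambda>_. 0)) lborel (\<lambda>y. \<Sum>i<n. a i * y i)
    (normal_density 0 (\<sigma> * sqrt (\<Sum>i<n. (a i)\<^sup>2)))"
proof -
  interpret prob_space "gauss \<sigma> n (\<lambda>_. 0)" by (rule prob_space_gauss[OF s])
  \<comment> \<open>A zero multiple of a coordinate has no normal density, so only non-zero
    coefficients are kept; the positive variance leaves at least one.\<close>
  define I where "I = {i. i < n \<and> a i \<noteq> 0}"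
  have I: "finite I" "I \<noteq> {}"
  proof -
    show "finite I" by (simp add: I_def)
    show "I \<noteq> {}"
    proof
      assume "I = {}"
      then have "(\<Sum>i<n. (a i)\<^sup>2) = 0" by (auto simp: I_def)
      then show False using a by simp
    qed
  qed
  have sumI: "(\<Sum>i<n. a i * y i) = (\<Sum>i\<in>I. a i * y i)" for y
    unfolding I_def by (intro sum.mono_neutral_right) auto
  have sumI2: "(\<Sum>i<n. (a i)\<^sup>2) = (\<Sum>i\<in>I. (a i)\<^sup>2)"
    unfolding I_def by (intro sum.mono_neutral_right) auto
  have n0: "{..<n} \<noteq> {}" using I by (auto simp: I_def)
  have comp: "distr (gauss \<sigma> n (\<lambda>_. 0)) borel (\<lambda>y. y i) = density lborel (normal_density 0 \<sigma>)" if "i < n" for i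
  proof -
    have "distr (gauss \<sigma> n (\<lambda>_. 0)) (density lborel (normal_density 0 \<sigma>)) (\<lambda>y. y i) = density lborel (normal_density 0 \<sigma>)"
      unfolding gauss_def
      using that by (intro distr_PiM_component) (auto intro: prob_space_normal_density s)
    then show ?thesis by (metis distr_cong sets_density sets_lborel)
  qed
  have ind: "indep_vars (\<lambda>_. borel) (\<lambda>i y. y i) {..<n}"
  proof (subst indep_vars_iff_distr_eq_PiM'[OF n0])
    show "random_variable borel (\<lambda>y. y i)" if "i \<in> {..<n}" for i using that by measurable
    have "distr (gauss \<sigma> n (\<lambda>_. 0)) (PiM {..<n} (\<lambda>_. borel)) (\<lambda>x. \<lambda>i\<in>{..<n}. x i) = gauss \<sigma> n (\<lambda>_. 0)"
      by (rule trans[OF distr_cong distr_id2]) (auto simp: space_gauss sets_gauss)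
    also have "\<dots> = (\<Pi>\<^sub>M i\<in>{..<n}. distr (gauss \<sigma> n (\<lambda>_. 0)) borel (\<lambda>x. x i))"
      unfolding gauss_def[of \<sigma> n "\<lambda>_. 0"]
      by (intro PiM_cong refl) (use comp in \<open>simp add: gauss_def\<close>)
    finally show "distr (gauss \<sigma> n (\<lambda>_. 0)) (PiM {..<n} (\<lambda>_. borel)) (\<lambda>x. \<lambda>i\<in>{..<n}. x i)
      = (\<Pi>\<^sub>M i\<in>{..<n}. distr (gauss \<sigma> n (\<lambda>_. 0)) borel (\<lambda>x. x i))" .
  qed
  have ind2: "indep_vars (\<lambda>_. borel) (\<lambda>i y. a i * y i) I"
    by (rule indep_vars_compose2[OF indep_vars_subset[OF ind], of I "\<lambda>i x. a i * x"]) (auto simp: I_def)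
  have nrm: "distributed (gauss \<sigma> n (\<lambda>_. 0)) lborel (\<lambda>y. a i * y i) (normal_density 0 (\<bar>a i\<bar> * \<sigma>))" if "i \<in> I" for i
  proof -
    have "distributed (gauss \<sigma> n (\<lambda>_. 0)) lborel (\<lambda>y. y i) (normal_density 0 \<sigma>)"
      unfolding distributed_def
      using that comp[of i]
      by (auto simp: I_def intro!: trans[OF distr_cong comp[of i]])
    from normal_density_affine[OF this s, of "a i" 0] that show ?thesis by (auto simp: I_def)
  qed
  have "distributed (gauss \<sigma> n (\<lambda>_. 0)) lborel (\<lambda>y. \<Sum>i\<in>I. a i * y i)
     (normal_density (\<Sum>i\<in>I. 0) (sqrt (\<Sum>i\<in>I. (\<bar>a i\<bar> * \<sigma>)\<^sup>2)))"
    by (rule sum_indep_normal[OF I ind2 _ nrm]) (use s in \<open>auto simp: I_def\<close>)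
  moreover have "sqrt (\<Sum>i\<in>I. (\<bar>a i\<bar> * \<sigma>)\<^sup>2) = \<sigma> * sqrt (\<Sum>i\<in>I. (a i)\<^sup>2)"
  proof -
    have "(\<Sum>i\<in>I. (\<bar>a i\<bar> * \<sigma>)\<^sup>2) = \<sigma>\<^sup>2 * (\<Sum>i\<in>I. (a i)\<^sup>2)"
      by (simp add: power_mult_distrib sum_distrib_left mult.commute)
    then show ?thesis using s by (simp add: real_sqrt_mult)
  qed
  ultimately show ?thesis by (simp only: sumI sumI2 sum.neutral_const)
qed

lemma normal_density_le: "0 < \<sigma> \<Longrightarrow> normal_density \<mu> \<sigma> x \<le> 1 / \<sigma>"
proof -
  assume s: "0 < \<sigma>"
  have "\<sigma> \<le> sqrt (2 * pi * \<sigma>\<^sup>2)"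
  proof (rule real_le_rsqrt)
    have "1 * \<sigma>\<^sup>2 \<le> 2 * pi * \<sigma>\<^sup>2" using pi_gt3 by (intro mult_right_mono) auto
    then show "\<sigma>\<^sup>2 \<le> 2 * pi * \<sigma>\<^sup>2" by simp
  qed
  then have "1 / sqrt (2 * pi * \<sigma>\<^sup>2) \<le> 1 / \<sigma>" using s by (intro divide_left_mono) auto
  moreover have "exp (- (x - \<mu>)\<^sup>2 / (2 * \<sigma>\<^sup>2)) \<le> 1" by simp
  ultimately show ?thesis unfolding normal_density_def
    using s by (smt (verit) mult_left_le divide_nonneg_nonneg real_sqrt_ge_zero mult_nonneg_nonneg pi_ge_zero zero_le_power2)
qed

text \<open>Anti-concentration: interval length times the maximal density. It will pay for the
  vanishing corrections in the coordinates below k - 1.\<close>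

lemma gauss_linear_near:
  assumes s: "0 < \<sigma>" and a: "0 < (\<Sum>i<n. (a i)\<^sup>2)" and e: "0 \<le> e"
  shows "measure (gauss \<sigma> n (\<lambda>_. 0)) {y \<in> space (gauss \<sigma> n (\<lambda>_. 0)). \<bar>(\<Sum>i<n. a i * y i) - c\<bar> \<le> e}
    \<le> 2 * e / (\<sigma> * sqrt (\<Sum>i<n. (a i)\<^sup>2))"
proof -
  interpret prob_space "gauss \<sigma> n (\<lambda>_. 0)" by (rule prob_space_gauss[OF s])
  define r where "r = \<sigma> * sqrt (\<Sum>i<n. (a i)\<^sup>2)"
  have r: "0 < r" using s a by (simp add: r_def)
  note D = gauss_linear_distributed[OF s a, folded r_def]
  have eq: "{y \<in> space (gauss \<sigma> n (\<lambda>_. 0)). \<bar>(\<Sum>i<n. a i * y i) - c\<bar> \<le> e}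
     = (\<lambda>y. \<Sum>i<n. a i * y i) -` {c-e..c+e} \<inter> space (gauss \<sigma> n (\<lambda>_. 0))" by auto
  have "emeasure (gauss \<sigma> n (\<lambda>_. 0)) {y \<in> space (gauss \<sigma> n (\<lambda>_. 0)). \<bar>(\<Sum>i<n. a i * y i) - c\<bar> \<le> e}
     = (\<integral>\<^sup>+x. ennreal (normal_density 0 r x) * indicator {c-e..c+e} x \<partial>lborel)"
    unfolding eq by (rule distributed_emeasure[OF D]) auto
  also have "\<dots> \<le> (\<integral>\<^sup>+x. ennreal (1 / r) * indicator {c-e..c+e} x \<partial>lborel)"
    by (intro nn_integral_mono mult_right_mono ennreal_leI normal_density_le r) auto
  also have "\<dots> = ennreal (2 * e / r)"
    using e r by (simp add: nn_integral_cmult flip: ennreal_mult)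
  finally show ?thesis
    using e r unfolding emeasure_eq_measure r_def[symmetric] by simp
qed

text \<open>The smallest variance bounds the exponent and the largest one the normalisation. A
  variance confined to an interval thus gets one constant, which can be chosen before the
  design.\<close>

lemma gauss_linear_window:
  assumes s: "0 < \<sigma>" and a: "v1 \<le> (\<Sum>i<n. (a i)\<^sup>2)" "(\<Sum>i<n. (a i)\<^sup>2) \<le> v2" and v1: "0 < v1"
    and e: "e1 \<le> e2" and m: "\<bar>e1\<bar> \<le> m" "\<bar>e2\<bar> \<le> m"
  shows "measure (gauss \<sigma> n (\<lambda>_. 0)) {y \<in> space (gauss \<sigma> n (\<lambda>_. 0)). e1 < (\<Sum>i<n. a i * y i) \<and> (\<Sum>i<n. a i * y i) \<le> e2}
    \<ge> (e2 - e1) * (exp (- m\<^sup>2 / (2 * \<sigma>\<^sup>2 * v1)) / (sqrt (2 * pi * \<sigma>\<^sup>2 * v2)))"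
proof -
  interpret prob_space "gauss \<sigma> n (\<lambda>_. 0)" by (rule prob_space_gauss[OF s])
  define r where "r = \<sigma> * sqrt (\<Sum>i<n. (a i)\<^sup>2)"
  define b where "b = exp (- m\<^sup>2 / (2 * \<sigma>\<^sup>2 * v1)) / (sqrt (2 * pi * \<sigma>\<^sup>2 * v2))"
  have a0: "0 < (\<Sum>i<n. (a i)\<^sup>2)" using a v1 by simp
  have r: "0 < r" using s a0 by (simp add: r_def)
  have b0: "0 \<le> b" using a v1 a0 by (simp add: b_def)
  have r2: "r\<^sup>2 = \<sigma>\<^sup>2 * (\<Sum>i<n. (a i)\<^sup>2)" using a0 by (simp add: r_def power_mult_distrib)
  note D = gauss_linear_distributed[OF s a0, folded r_def]
  have eq: "{y \<in> space (gauss \<sigma> n (\<lambda>_. 0)). e1 < (\<Sum>i<n. a i * y i) \<and> (\<Sum>i<n. a i * y i) \<le> e2}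
     = (\<lambda>y. \<Sum>i<n. a i * y i) -` {e1<..e2} \<inter> space (gauss \<sigma> n (\<lambda>_. 0))" by auto
  have "ennreal ((e2 - e1) * b) = (\<integral>\<^sup>+x. ennreal b * indicator {e1<..e2} x \<partial>lborel)"
    using e b0 by (simp add: nn_integral_cmult mult.commute flip: ennreal_mult)
  also have "\<dots> \<le> (\<integral>\<^sup>+x. ennreal (normal_density 0 r x) * indicator {e1<..e2} x \<partial>lborel)"
  proof (rule nn_integral_mono)
    fix x :: real
    have "b \<le> normal_density 0 r x" if "e1 < x" "x \<le> e2"
    proof -
      have "\<bar>x\<bar> \<le> m" using that m by linarith
      then have xm: "x\<^sup>2 \<le> m\<^sup>2" by (metis abs_ge_zero power2_abs power_mono)
      have "x\<^sup>2 / (2 * r\<^sup>2) \<le> m\<^sup>2 / (2 * \<sigma>\<^sup>2 * v1)"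
        using xm a v1 s unfolding r2 by (intro frac_le) (auto simp: mult.assoc)
      moreover have "sqrt (2 * pi * r\<^sup>2) \<le> sqrt (2 * pi * \<sigma>\<^sup>2 * v2)"
        using a s unfolding r2 by (intro real_sqrt_le_mono) (auto simp: mult.assoc)
      ultimately have "b \<le> exp (- (x\<^sup>2 / (2 * r\<^sup>2))) / sqrt (2 * pi * r\<^sup>2)"
        unfolding b_def using r by (intro frac_le) auto
      then show ?thesis by (simp add: normal_density_def)
    qed
    then show "ennreal b * indicator {e1<..e2} x \<le> ennreal (normal_density 0 r x) * indicator {e1<..e2} x"
      by (auto simp: indicator_def)
  qed
  also have "\<dots> = emeasure (gauss \<sigma> n (\<lambda>_. 0)) {y \<in> space (gauss \<sigma> n (\<lambda>_. 0)). e1 < (\<Sum>i<n. a i * y i) \<and> (\<Sum>i<n. a i * y i) \<le> e2}"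
    unfolding eq by (rule distributed_emeasure[OF D, symmetric]) auto
  finally show ?thesis
    unfolding emeasure_eq_measure b_def by simp
qed

lemma gauss_linear_tail:
  assumes s: "0 < \<sigma>" and a: "0 < (\<Sum>i<n. (a i)\<^sup>2)" and c: "0 < c"
  shows "measure (gauss \<sigma> n (\<lambda>_. 0)) {y \<in> space (gauss \<sigma> n (\<lambda>_. 0)). c < (\<Sum>i<n. a i * y i)}
    \<le> \<sigma>\<^sup>2 * (\<Sum>i<n. (a i)\<^sup>2) / c\<^sup>2"
proof -
  interpret prob_space "gauss \<sigma> n (\<lambda>_. 0)" by (rule prob_space_gauss[OF s])
  define r where "r = \<sigma> * sqrt (\<Sum>i<n. (a i)\<^sup>2)"
  have r: "0 < r" using s a by (simp add: r_def)
  have r2: "r\<^sup>2 = \<sigma>\<^sup>2 * (\<Sum>i<n. (a i)\<^sup>2)" using a by (simp add: r_def power_mult_distrib)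
  define S where "S = (\<lambda>y. \<Sum>i<n. a i * y i)"
  note D = gauss_linear_distributed[OF s a, folded r_def S_def]
  have E: "expectation S = 0" by (rule normal_distributed_expectation[OF r D])
  have V: "variance S = r\<^sup>2" by (rule normal_distributed_variance[OF r D])
  have [measurable]: "S \<in> borel_measurable (gauss \<sigma> n (\<lambda>_. 0))" unfolding S_def by measurable
  \<comment> \<open>A non-integrable function has integral 0 by convention, whereas the variance is
    \<open>r\<^sup>2\<close> > 0.\<close>
  have "integrable (gauss \<sigma> n (\<lambda>_. 0)) (\<lambda>y. (S y)\<^sup>2)"
  proof (rule ccontr)
    assume "\<not> integrable (gauss \<sigma> n (\<lambda>_. 0)) (\<lambda>y. (S y)\<^sup>2)"
    then show False using V E r by (simp add: not_integrable_integral_eq)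
  qed
  from Chebyshev_inequality[OF _ this c]
  have "prob {y \<in> space (gauss \<sigma> n (\<lambda>_. 0)). c \<le> \<bar>S y\<bar>} \<le> r\<^sup>2 / c\<^sup>2" using E V by simp
  moreover have "prob {y \<in> space (gauss \<sigma> n (\<lambda>_. 0)). c < S y} \<le> prob {y \<in> space (gauss \<sigma> n (\<lambda>_. 0)). c \<le> \<bar>S y\<bar>}"
    by (rule finite_measure_mono) auto
  ultimately show ?thesis unfolding r2 S_def by linarith
qed

section \<open>The model averaging weight\<close>

text \<open>In terms of \<open>w = sqrt n * betaU $ (k - 1)\<close> the weight of the restricted estimator is
  \<open>wgt c a w\<close> with \<open>c = exp (-2 \<alpha>)\<close> and \<open>a\<close> converging to \<open>\<alpha> * Q $$ (k - 1, k - 1) / \<sigma>\<^sup>2\<close>.\<close>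

definition wgt :: "real \<Rightarrow> real \<Rightarrow> real \<Rightarrow> real" where
  "wgt c a w = inverse (1 + c * exp (a * w\<^sup>2))"

text \<open>The last coordinate of the averaged estimator, scaled by sqrt n: the restricted
  estimator is 0 there, so only the unrestricted one with its weight survives.\<close>

definition shrink :: "real \<Rightarrow> real \<Rightarrow> real \<Rightarrow> real" where
  "shrink c a w = w * (1 - wgt c a w)"

lemma wgt_pos: "0 < c \<Longrightarrow> 0 < wgt c a w"
  by (simp add: wgt_def add_pos_pos)

lemma wgt_less_1: "0 < c \<Longrightarrow> wgt c a w < 1"
  by (simp add: wgt_def field_simps add_pos_pos)

lemma wgt_measurable [measurable]: "wgt c a \<in> borel_measurable borel"
  unfolding wgt_def[abs_def] by measurable

lemma wgt_antimono: "0 < c \<Longrightarrow> 0 < a \<Longrightarrow> \<bar>v\<bar> \<le> \<bar>w\<bar> \<Longrightarrow> wgt c a w \<le> wgt c a v"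
  unfolding wgt_def by (intro le_imp_inverse_le add_left_mono mult_left_mono)
    (auto simp: abs_le_square_iff add_pos_pos)

lemma shrink_minus: "shrink c a (- w) = - shrink c a w"
  by (simp add: shrink_def wgt_def)

text \<open>On non-negative arguments both factors grow, the first one strictly. Oddness covers
  negative arguments, and arguments of opposite sign are separated by 0.\<close>

lemma shrink_strict_mono:
  assumes c: "0 < c" and a: "0 < a"
  shows "v < w \<Longrightarrow> shrink c a v < shrink c a w"
proof -
  have pos: "shrink c a v < shrink c a w" if "0 \<le> v" "v < w" for v w
    unfolding shrink_def using that c a wgt_antimono[of c a v w] wgt_less_1[OF c, of a v]
    by (intro mult_less_le_imp_less) auto
  assume "v < w"
  consider "0 \<le> v" | "w \<le> 0" | "v < 0" "0 < w" by linarith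
  then show ?thesis
  proof cases
    case 2 then show ?thesis using pos[of "-w" "-v"] \<open>v < w\<close> by (simp add: shrink_minus)
  next
    case 3
    then have "shrink c a v < 0" "0 < shrink c a w"
      using wgt_less_1[OF c] by (auto simp: shrink_def mult_neg_pos)
    then show ?thesis by linarith
  qed (use pos \<open>v < w\<close> in auto)
qed

lemma shrink_mono: "0 < c \<Longrightarrow> 0 < a \<Longrightarrow> v \<le> w \<Longrightarrow> shrink c a v \<le> shrink c a w"
  using shrink_strict_mono[of c a v w] by (cases "v = w") auto

lemma shrink_cont: "0 < c \<Longrightarrow> continuous_on A (shrink c a)"
  unfolding shrink_def[abs_def] wgt_def
  by (intro continuous_intros) (smt (verit) exp_gt_zero mult_pos_pos)

lemma tendsto_shrink:
  assumes "0 < c" "(a \<longlongrightarrow> a0) F"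
  shows "((\<lambda>n. shrink c (a n) w) \<longlongrightarrow> shrink c a0 w) F"
proof -
  have "1 + c * exp (a0 * w\<^sup>2) \<noteq> 0"
    using mult_pos_pos[OF assms(1) exp_gt_zero[of "a0 * w\<^sup>2"]] by linarith
  then show ?thesis unfolding shrink_def wgt_def by (intro tendsto_intros assms(2))
qed

lemma shrink_surj:
  assumes c: "0 < c" and a: "0 < a"
  obtains w where "shrink c a w = x"
proof -
  have pos: "\<exists>w. shrink c a w = x" if x: "0 \<le> x" for x
  proof -
    \<comment> \<open>\<open>l\<close> is the smallest value of 1 - \<open>wgt\<close>, so
      \<open>shrink\<close> has passed x at x / l and the intermediate value theorem applies on
      [0, x / l].\<close>
    define l where "l = 1 - wgt c a 0"
    have l: "0 < l" using wgt_less_1[OF c] by (simp add: l_def)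
    have "x / l * (1 - wgt c a (x / l)) \<ge> x / l * l"
      unfolding l_def using x l wgt_antimono[OF c a, of 0 "x / l"]
      by (intro mult_left_mono) (auto simp: l_def)
    then have "x \<le> shrink c a (x / l)" using l by (simp add: shrink_def)
    moreover have "shrink c a 0 \<le> x" using x by (simp add: shrink_def)
    ultimately show ?thesis
      using IVT'[of "shrink c a" 0 x "x / l"] x l shrink_cont[OF c] by auto
  qed
  show ?thesis
  proof (cases "0 \<le> x")
    case True then show ?thesis using pos that by blast
  next
    case False
    then obtain w where "shrink c a w = - x" using pos[of "-x"] by auto
    then have "shrink c a (- w) = x" by (simp add: shrink_minus)
    then show ?thesis by (rule that)
  qed
qed

text \<open>The local asymptotic distribution of the estimator of the last coefficient is the normal
  distribution function evaluated at \<open>local_cut c a t g\<close>, \<open>g\<close> being the local parameter.\<close>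

definition local_cut :: "real \<Rightarrow> real \<Rightarrow> real \<Rightarrow> real \<Rightarrow> real" where
  "local_cut c a t g = (SOME w. shrink c a w = t + g) - g"

lemma shrink_local_cut:
  assumes "0 < c" "0 < a"
  shows "shrink c a (local_cut c a t g + g) = t + g"
proof -
  obtain w where "shrink c a w = t + g" by (rule shrink_surj[OF assms])
  then have "shrink c a (SOME w. shrink c a w = t + g) = t + g" by (rule someI)
  then show ?thesis by (simp add: local_cut_def)
qed

lemma local_cut_eqI: "0 < c \<Longrightarrow> 0 < a \<Longrightarrow> shrink c a w = t + g \<Longrightarrow> local_cut c a t g = w - g"
  using shrink_local_cut[of c a t g] shrink_strict_mono[of c a w "local_cut c a t g + g"]
    shrink_strict_mono[of c a "local_cut c a t g + g" w]
  by (cases w "local_cut c a t g + g" rule: linorder_cases) auto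

text \<open>For t \<noteq> 0, the choice g = - t is solved by w = 0 and gives the cut t, while at g
  = 0 a cut t would require \<open>shrink\<close> to fix t, which a positive weight forbids. For t =
  0 these parameters coincide, so the parameter solved by w = 1 is taken instead.\<close>

lemma local_cut_nonconstant:
  assumes c: "0 < c" and a: "0 < a"
  obtains g where "local_cut c a t g \<noteq> local_cut c a t 0"
proof (cases "t = 0")
  case True
  have "local_cut c a t 0 = 0" using local_cut_eqI[OF c a, of 0 t 0] True by (simp add: shrink_def)
  moreover have "local_cut c a t (shrink c a 1) = 1 - shrink c a 1"
    using local_cut_eqI[OF c a, of 1 t "shrink c a 1"] True by simp
  moreover have "shrink c a 1 < 1" using wgt_pos[OF c] by (simp add: shrink_def)
  ultimately show ?thesis using that by force
next
  case False
  have 1: "local_cut c a t (- t) = t" using local_cut_eqI[OF c a, of 0 t "- t"] by (simp add: shrink_def)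
  have "shrink c a t \<noteq> t" using False wgt_pos[OF c, of a t] by (simp add: shrink_def)
  then have "local_cut c a t 0 \<noteq> t" using shrink_local_cut[OF c a, of t 0] by auto
  then show ?thesis using 1 that by metis
qed

text \<open>The exponential in the weight beats the linear factor. The bound is uniform in w, so
  averaging moves coordinate j < k - 1 by at most a constant times H_jk / H_kk.\<close>

lemma wgt_mult_bound:
  assumes c: "0 < c" and a: "0 < a"
  shows "\<bar>wgt c a w * w\<bar> \<le> (1 + 1 / a) / c"
proof -
  have "wgt c a w \<le> inverse (c * exp (a * w\<^sup>2))"
    unfolding wgt_def using c by (intro le_imp_inverse_le) auto
  also have "\<dots> \<le> inverse (c * (1 + a * w\<^sup>2))"
    using c a by (intro le_imp_inverse_le mult_left_mono exp_ge_add_one_self mult_pos_pos add_pos_nonneg) auto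
  finally have "wgt c a w * \<bar>w\<bar> \<le> inverse (c * (1 + a * w\<^sup>2)) * \<bar>w\<bar>"
    by (intro mult_right_mono) auto
  also have "\<dots> = \<bar>w\<bar> / (1 + a * w\<^sup>2) / c"
    by (simp add: field_simps)
  also have "\<bar>w\<bar> / (1 + a * w\<^sup>2) \<le> 1 + 1 / a"
  proof -
    have "\<bar>w\<bar> \<le> 1 + w\<^sup>2" using zero_le_power2[of "\<bar>w\<bar> - 1"] by (simp add: power2_eq_square algebra_simps)
    also have "\<dots> \<le> (1 + 1 / a) * (1 + a * w\<^sup>2)"
      using a by (simp add: field_simps)
    finally show ?thesis
      using a by (simp add: divide_le_eq add_pos_nonneg)
  qed
  finally show ?thesis
    using c wgt_pos[OF c, of a w] by (simp add: abs_mult divide_right_mono)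
qed

section \<open>Least squares algebra\<close>

lemma mat_vec_index:
  assumes "A \<in> carrier_mat n k" "v \<in> carrier_vec k" "i < n"
  shows "(A *\<^sub>v v) $ i = (\<Sum>j<k. A $$ (i, j) * v $ j)"
  using assms by (auto simp: scalar_prod_def atLeast0LessThan intro!: sum.cong)

lemma mat_mat_index:
  assumes "A \<in> carrier_mat n m" "B \<in> carrier_mat m k" "i < n" "j < k"
  shows "(A * B) $$ (i, j) = (\<Sum>l<m. A $$ (i, l) * B $$ (l, j))"
  using assms by (auto simp: scalar_prod_def atLeast0LessThan intro!: sum.cong)

lemma gram_index:
  assumes "A \<in> carrier_mat n k" "i < k" "j < k"
  shows "(transpose_mat A * A) $$ (i, j) = (\<Sum>l<n. A $$ (l, i) * A $$ (l, j))"
  using assms by (subst mat_mat_index[of _ k n _ k]) auto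

lemma transpose_vec_index:
  assumes "A \<in> carrier_mat n k" "v \<in> carrier_vec n" "i < k"
  shows "(transpose_mat A *\<^sub>v v) $ i = (\<Sum>l<n. A $$ (l, i) * v $ l)"
  using assms by (subst mat_vec_index[of _ k n]) auto

text \<open>Two-sided inverses are unique, so the inverse inside the estimators may be replaced by
  one in closed form.\<close>

lemma mat_inv_eqI:
  assumes G: "G \<in> carrier_mat k k" and H: "H \<in> carrier_mat k k"
    and GH: "G * H = 1\<^sub>m k" and HG: "H * G = 1\<^sub>m k"
  shows "mat_inv G = H"
proof (cases "mat_inverse G")
  case None
  \<comment> \<open>\<open>G\<close> is a unit, so elimination cannot report \<open>None\<close>, on
    which \<open>the\<close> would be unspecified.\<close>
  have "G \<in> Units (ring_mat TYPE(real) k ())"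
    unfolding Units_def using assms by (auto simp: ring_mat_def)
  then show ?thesis using mat_inverse(1)[OF G None, where b = "()"] by blast
next
  case (Some B)
  then have B: "G * B = 1\<^sub>m k" "B * G = 1\<^sub>m k" "B \<in> carrier_mat k k"
    using mat_inverse(2)[OF G Some] by auto
  have "B = B * (G * H)" using B GH by simp
  also have "\<dots> = (B * G) * H" by (rule assoc_mult_mat[symmetric, OF B(3) G H])
  also have "\<dots> = H" using B H by simp
  finally show ?thesis using Some by (simp add: mat_inv_def)
qed

text \<open>Cramer's rule: the entries are quotients of polynomials in the entries of the matrix,
  which makes continuity of inversion evident.\<close>

definition adj_inv :: "real mat \<Rightarrow> real mat" where
  "adj_inv A = (1 / det A) \<cdot>\<^sub>m adj_mat A"

lemma adj_inv:
  assumes A: "A \<in> carrier_mat k k" and d: "det A \<noteq> 0"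
  shows "adj_inv A \<in> carrier_mat k k" "A * adj_inv A = 1\<^sub>m k" "adj_inv A * A = 1\<^sub>m k"
proof -
  note m = adj_mat[OF A]
  show "adj_inv A \<in> carrier_mat k k" using m by (simp add: adj_inv_def)
  show "A * adj_inv A = 1\<^sub>m k"
    unfolding adj_inv_def mult_smult_distrib[OF A m(1)] m(2) using d by (intro eq_matI) auto
  show "adj_inv A * A = 1\<^sub>m k"
    unfolding adj_inv_def mult_smult_assoc_mat[OF m(1) A] m(3) using d by (intro eq_matI) auto
qed

section \<open>Continuity of inversion and positive definite limits\<close>

lemma tendsto_det:
  fixes S :: "nat \<Rightarrow> real mat"
  assumes S: "\<And>n. S n \<in> carrier_mat k k" and Q: "Q \<in> carrier_mat k k"
    and lim: "\<And>i j. i < k \<Longrightarrow> j < k \<Longrightarrow> (\<lambda>n. S n $$ (i, j)) \<longlonglongrightarrow> Q $$ (i, j)"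
  shows "(\<lambda>n. det (S n)) \<longlonglongrightarrow> det Q"
  unfolding det_def'[OF S] det_def'[OF Q]
  by (intro tendsto_sum tendsto_mult tendsto_const tendsto_prod lim)
     (use permutes_in_image in fastforce)+

lemma tendsto_adj_inv:
  fixes S :: "nat \<Rightarrow> real mat"
  assumes S: "\<And>n. S n \<in> carrier_mat k k" and Q: "Q \<in> carrier_mat k k"
    and lim: "\<And>i j. i < k \<Longrightarrow> j < k \<Longrightarrow> (\<lambda>n. S n $$ (i, j)) \<longlonglongrightarrow> Q $$ (i, j)"
    and d: "det Q \<noteq> 0" and ij: "i < k" "j < k"
  shows "(\<lambda>n. adj_inv (S n) $$ (i, j)) \<longlonglongrightarrow> adj_inv Q $$ (i, j)"
proof -
  have dim: "dim_row (S n) = k" "dim_col (S n) = k" for n using S[of n] by auto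
  have dimQ: "dim_row Q = k" "dim_col Q = k" using Q by auto
  have "(\<lambda>n. det (mat_delete (S n) j i)) \<longlonglongrightarrow> det (mat_delete Q j i)"
  proof (rule tendsto_det[of _ "k - 1"])
    show "mat_delete (S n) j i \<in> carrier_mat (k - 1) (k - 1)" for n
      by (simp add: mat_delete_def dim)
    show "mat_delete Q j i \<in> carrier_mat (k - 1) (k - 1)" by (simp add: mat_delete_def dimQ)
    show "(\<lambda>n. mat_delete (S n) j i $$ (a, b)) \<longlonglongrightarrow> mat_delete Q j i $$ (a, b)"
      if "a < k - 1" "b < k - 1" for a b
      using that by (auto simp: mat_delete_def dim dimQ intro!: lim)
  qed
  then have "(\<lambda>n. 1 / det (S n) * ((-1) ^ (j + i) * det (mat_delete (S n) j i)))
     \<longlonglongrightarrow> 1 / det Q * ((-1) ^ (j + i) * det (mat_delete Q j i))"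
    by (intro tendsto_mult[OF tendsto_divide[OF tendsto_const tendsto_det[OF S Q lim] d]]
        tendsto_mult[OF tendsto_const])
  then show ?thesis using ij by (simp add: adj_inv_def adj_mat_def cofactor_def dim dimQ)
qed

lemma pos_def_det_nz:
  assumes Q: "Q \<in> carrier_mat k k" "pos_def_mat Q"
  shows "det Q \<noteq> 0"
proof
  assume "det Q = 0"
  then obtain v where v: "v \<in> carrier_vec k" "v \<noteq> 0\<^sub>v k" "Q *\<^sub>v v = 0\<^sub>v k"
    using det_0_iff_vec_prod_zero_field[OF Q(1)] by blast
  then have "v \<bullet> (Q *\<^sub>v v) > 0" using Q by (auto simp: pos_def_mat_def)
  then show False using v by simp
qed

text \<open>For c the j-th column of R, Q c is a unit vector, so the diagonal entry is the quadratic
  form of Q at c, and c cannot vanish.\<close>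

lemma pos_def_inv_diag_pos:
  assumes Q: "Q \<in> carrier_mat k k" "pos_def_mat Q" and R: "R \<in> carrier_mat k k" "Q * R = 1\<^sub>m k"
    and j: "j < k"
  shows "0 < R $$ (j, j)"
proof -
  have c: "col R j \<in> carrier_vec k" using R by auto
  have Qc: "Q *\<^sub>v col R j = col (1\<^sub>m k) j" using R Q j by (metis col_mult2)
  have "col R j \<noteq> 0\<^sub>v k"
  proof
    assume "col R j = 0\<^sub>v k"
    then have "(Q *\<^sub>v col R j) $ j = 0"
      using mat_vec_index[OF Q(1) c j] by simp
    then show False unfolding Qc using j by simp
  qed
  then have "0 < col R j \<bullet> (Q *\<^sub>v col R j)" using Q c by (auto simp: pos_def_mat_def)
  also have "\<dots> = R $$ (j, j)"
    unfolding Qc using j R c by simp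
  finally show ?thesis .
qed

text \<open>The last column of Q is a multiple of a unit vector, so the entry of R Q in that column
  has a single term. This is where the vanishing block enters.\<close>

lemma inv_last_col:
  fixes Q R :: "real mat"
  assumes Q: "Q \<in> carrier_mat k k" and R: "R \<in> carrier_mat k k" "R * Q = 1\<^sub>m k"
    and k: "0 < k" and z: "\<forall>j<k - 1. Q $$ (j, k - 1) = 0" and j: "j < k"
  shows "R $$ (j, k - 1) * Q $$ (k - 1, k - 1) = (if j = k - 1 then 1 else 0)"
proof -
  have "(if j = k - 1 then 1 else 0) = (R * Q) $$ (j, k - 1)" using R j k by simp
  also have "\<dots> = (\<Sum>l<k. R $$ (j, l) * Q $$ (l, k - 1))"
    using R Q j k by (intro mat_mat_index) auto
  also have "\<dots> = (\<Sum>l\<in>{k - 1}. R $$ (j, l) * Q $$ (l, k - 1))"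
    using z k by (intro sum.mono_neutral_right) auto
  finally show ?thesis by simp
qed

text \<open>The determinant of X'X / n tends to det Q and is eventually non-zero. \<open>H\<close>
  is the adjugate inverse of X'X / n divided by n, so n H inherits its limit.\<close>

lemma gram_inv_eventually:
  assumes A: "\<And>n. X n \<in> carrier_mat n k" and Q: "Q \<in> carrier_mat k k" and d: "det Q \<noteq> 0"
    and lim: "\<And>i j. i < k \<Longrightarrow> j < k \<Longrightarrow>
      (\<lambda>n. (transpose_mat (X n) * X n) $$ (i, j) / real n) \<longlonglongrightarrow> Q $$ (i, j)"
  obtains H where "\<forall>\<^sub>F n in sequentially. H n \<in> carrier_mat k k \<and> transpose_mat (X n) * X n * H n = 1\<^sub>m k
      \<and> H n * (transpose_mat (X n) * X n) = 1\<^sub>m k"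
    and "\<And>i j. i < k \<Longrightarrow> j < k \<Longrightarrow> (\<lambda>n. real n * H n $$ (i, j)) \<longlonglongrightarrow> adj_inv Q $$ (i, j)"
proof -
  define G where "G n = transpose_mat (X n) * X n" for n
  define S where "S n = (1 / real n) \<cdot>\<^sub>m G n" for n
  have G: "G n \<in> carrier_mat k k" for n using A[of n] by (simp add: G_def)
  have S: "S n \<in> carrier_mat k k" for n using G[of n] by (simp add: S_def)
  have Slim: "(\<lambda>n. S n $$ (i, j)) \<longlonglongrightarrow> Q $$ (i, j)" if "i < k" "j < k" for i j
    using lim[OF that] that G[THEN carrier_matD(1)] G[THEN carrier_matD(2)] by (simp add: S_def G_def[symmetric])
  define H where "H n = (1 / real n) \<cdot>\<^sub>m adj_inv (S n)" for n
  have ev: "\<forall>\<^sub>F n in sequentially. det (S n) \<noteq> 0"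
    using tendsto_imp_eventually_ne[OF tendsto_det[OF S Q Slim] d] by simp
  have ev': "\<forall>\<^sub>F n in sequentially. 0 < n \<and> det (S n) \<noteq> 0"
    using ev eventually_gt_at_top[of 0] by eventually_elim simp
  show ?thesis
  proof
    show "\<forall>\<^sub>F n in sequentially. H n \<in> carrier_mat k k \<and> transpose_mat (X n) * X n * H n = 1\<^sub>m k
      \<and> H n * (transpose_mat (X n) * X n) = 1\<^sub>m k"
      using ev'
    proof eventually_elim
      case (elim n)
      note I = adj_inv[OF S conjunct2[OF elim]]
      have Sn: "G n * ((1 / real n) \<cdot>\<^sub>m adj_inv (S n)) = S n * adj_inv (S n)"
        unfolding S_def using mult_smult_distrib[OF G I(1)] mult_smult_assoc_mat[OF G I(1)] by (simp add: S_def)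
      have Sn': "((1 / real n) \<cdot>\<^sub>m adj_inv (S n)) * G n = adj_inv (S n) * S n"
        unfolding S_def using mult_smult_distrib[OF I(1) G] mult_smult_assoc_mat[OF I(1) G] by (simp add: S_def)
      show ?case
        using I Sn Sn' by (simp add: H_def G_def[symmetric])
    qed
  next
    fix i j assume ij: "i < k" "j < k"
    have "\<forall>\<^sub>F n in sequentially. real n * H n $$ (i, j) = adj_inv (S n) $$ (i, j)"
      using ev'
    proof eventually_elim
      case (elim n)
      with adj_inv(1)[OF S conjunct2[OF elim]] ij show ?case by (auto simp: H_def)
    qed
    then show "(\<lambda>n. real n * H n $$ (i, j)) \<longlonglongrightarrow> adj_inv Q $$ (i, j)"
      using tendsto_adj_inv[OF S Q Slim d ij] by (simp add: tendsto_cong)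
  qed
qed

text \<open>Entry (j, i) of H X': the coefficient of observation i in the j-th least squares
  estimate when H inverts X'X.\<close>

definition ls_weight :: "real mat \<Rightarrow> real mat \<Rightarrow> nat \<Rightarrow> nat \<Rightarrow> real" where
  "ls_weight A H j i = (\<Sum>l<dim_col A. H $$ (j, l) * A $$ (i, l))"

text \<open>One sample size with an inverse of its Gram matrix. Everything here is exact;
  asymptotics enter later only through the entries of \<open>H\<close> and of the Gram
  matrix.\<close>

locale design_matrix =
  fixes X :: "nat \<Rightarrow> real mat" and n k :: nat and H :: "real mat"
  assumes A: "X n \<in> carrier_mat n k" and H: "H \<in> carrier_mat k k"
    and GH: "transpose_mat (X n) * X n * H = 1\<^sub>m k" and HG: "H * (transpose_mat (X n) * X n) = 1\<^sub>m k"
    and k: "1 < k" and Hdiag: "\<And>j. j < k \<Longrightarrow> 0 < H $$ (j, j)"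
begin

lemma Hpos: "0 < H $$ (k - 1, k - 1)" using k by (intro Hdiag) simp

abbreviation "G \<equiv> transpose_mat (X n) * X n"
abbreviation "b \<equiv> ls_weight (X n) H"

lemma G: "G \<in> carrier_mat k k" using A by simp

lemma b_eq: "b j i = (\<Sum>l<k. H $$ (j, l) * X n $$ (i, l))"
  using A by (simp add: ls_weight_def)

section \<open>Exact formulas for the least squares estimators\<close>

lemma weight_design: "j < k \<Longrightarrow> l < k \<Longrightarrow> (\<Sum>i<n. b j i * X n $$ (i, l)) = (if j = l then 1 else 0)"
proof -
  assume jl: "j < k" "l < k"
  have "(\<Sum>i<n. b j i * X n $$ (i, l)) = (\<Sum>i<n. \<Sum>m<k. H $$ (j, m) * (X n $$ (i, m) * X n $$ (i, l)))"
    by (simp add: b_eq sum_distrib_right mult.assoc)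
  also have "\<dots> = (\<Sum>m<k. H $$ (j, m) * G $$ (m, l))"
    by (subst sum.swap) (use gram_index[OF A _ jl(2)] in \<open>simp add: sum_distrib_left\<close>)
  also have "\<dots> = (H * G) $$ (j, l)"
    using mat_mat_index[OF H G jl] by simp
  finally show ?thesis using jl HG by simp
qed

text \<open>(H X')(H X')' = H: up to \<sigma>^2 this is the covariance of the estimates. The left
  side is symmetric in j and l, whence the symmetry of H.\<close>

lemma weight_weight: "j < k \<Longrightarrow> l < k \<Longrightarrow> (\<Sum>i<n. b j i * b l i) = H $$ (l, j)"
proof -
  assume jl: "j < k" "l < k"
  have "(\<Sum>i<n. b j i * b l i) = (\<Sum>i<n. \<Sum>m<k. H $$ (l, m) * (b j i * X n $$ (i, m)))"
    by (subst (2) b_eq) (simp add: sum_distrib_left mult_ac)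
  also have "\<dots> = (\<Sum>m<k. H $$ (l, m) * (if j = m then 1 else 0))"
    by (subst sum.swap) (use weight_design[OF jl(1)] in \<open>simp flip: sum_distrib_left\<close>)
  also have "\<dots> = H $$ (l, j)"
    using jl by (simp add: if_distrib[of "\<lambda>x. _ * x"] cong: if_cong)
  finally show ?thesis .
qed

lemma H_sym: "j < k \<Longrightarrow> l < k \<Longrightarrow> H $$ (j, l) = H $$ (l, j)"
  using weight_weight[of j l] weight_weight[of l j] by (simp add: mult.commute)

lemma betaU_carrier: "betaU X n Y \<in> carrier_vec k"
  using A H by (simp add: betaU_def mat_inv_eqI[OF G H GH HG])

lemma betaU_index: "j < k \<Longrightarrow> betaU X n Y $ j = (\<Sum>i<n. b j i * Y i)"
proof -
  assume j: "j < k"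
  have c: "transpose_mat (X n) *\<^sub>v vec n Y \<in> carrier_vec k" using A by simp
  have "betaU X n Y $ j = (\<Sum>l<k. H $$ (j, l) * (\<Sum>i<n. X n $$ (i, l) * Y i))"
    unfolding betaU_def mat_inv_eqI[OF G H GH HG] mat_vec_index[OF H c j]
    by (intro sum.cong refl arg_cong2[where f = "(*)"], subst transpose_vec_index[OF A]) auto
  also have "\<dots> = (\<Sum>i<n. \<Sum>l<k. H $$ (j, l) * (X n $$ (i, l) * Y i))"
    by (subst sum.swap) (simp add: sum_distrib_left)
  finally show ?thesis by (simp add: b_eq sum_distrib_right mult.assoc)
qed

lemma normal_eq: "i < k \<Longrightarrow> (\<Sum>j<k. G $$ (i, j) * betaU X n Y $ j) = (\<Sum>l<n. X n $$ (l, i) * Y l)"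
proof -
  assume i: "i < k"
  define y where "y = transpose_mat (X n) *\<^sub>v vec n Y"
  have c: "y \<in> carrier_vec k" using A by (simp add: y_def)
  have "(\<Sum>j<k. G $$ (i, j) * betaU X n Y $ j) = (G *\<^sub>v betaU X n Y) $ i"
    using mat_vec_index[OF G betaU_carrier i] by simp
  also have "G *\<^sub>v betaU X n Y = G * H *\<^sub>v y"
    unfolding betaU_def mat_inv_eqI[OF G H GH HG] y_def[symmetric]
    using assoc_mult_mat_vec[OF G H c] by simp
  also have "\<dots> = y" unfolding GH using c by simp
  also have "y $ i = (\<Sum>l<n. X n $$ (l, i) * Y l)"
    unfolding y_def by (subst transpose_vec_index[OF A _ i]) auto
  finally show ?thesis .
qed

text \<open>Subtracting the multiple of H e_k that annihilates the last coordinate changes X'X betaU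
  only in its last row. The first k - 1 normal equations therefore persist, and with last coordinate
  0 they are those of the restricted design, which has a unique solution.\<close>

lemma betaR_index:
  assumes j: "j < k"
  shows "betaR X k (k - 1) n Y $ j
    = betaU X n Y $ j - H $$ (j, k - 1) / H $$ (k - 1, k - 1) * betaU X n Y $ (k - 1)"
proof -
  define k' where "k' = k - 1"
  have k': "k' < k" "k = Suc k'" using k by (auto simp: k'_def)
  define X1 where "X1 = X1_of X k' n"
  have X1: "X1 \<in> carrier_mat n k'" and X1_index: "\<And>i j. i < n \<Longrightarrow> j < k' \<Longrightarrow> X1 $$ (i, j) = X n $$ (i, j)"
    using A by (auto simp: X1_def X1_of_def)
  define G1 where "G1 = transpose_mat X1 * X1"
  have G1: "G1 \<in> carrier_mat k' k'" using X1 by (simp add: G1_def)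
  have G1_index: "G1 $$ (i, j) = G $$ (i, j)" if "i < k'" "j < k'" for i j
    using that k' gram_index[OF X1 that] gram_index[OF A, of i j]
    by (simp add: G1_def X1_index)
  \<comment> \<open>A kernel vector v satisfies |X1 v|^2 = v' G1 v = 0; applying the left inverse H
    X' of the design then gives v = 0.\<close>
  have "det G1 \<noteq> 0"
  proof
    assume "det G1 = 0"
    then obtain v where v: "v \<in> carrier_vec k'" "v \<noteq> 0\<^sub>v k'" "G1 *\<^sub>v v = 0\<^sub>v k'"
      using det_0_iff_vec_prod_zero_field[OF G1] by blast
    define w where "w i = (\<Sum>j<k'. X n $$ (i, j) * v $ j)" for i
    have "(\<Sum>i<n. (w i)\<^sup>2) = (\<Sum>i<n. \<Sum>j<k'. v $ j * (\<Sum>l<k'. X n $$ (i, j) * X n $$ (i, l) * v $ l))"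
      by (simp add: w_def power2_eq_square sum_distrib_right sum_distrib_left mult_ac)
    also have "\<dots> = (\<Sum>j<k'. v $ j * (\<Sum>l<k'. (\<Sum>i<n. X n $$ (i, j) * X n $$ (i, l)) * v $ l))"
      unfolding sum_distrib_left sum_distrib_right
      by (rule trans[OF sum.swap]) (rule sum.cong[OF refl sum.swap])
    also have "\<dots> = (\<Sum>j<k'. v $ j * (G1 *\<^sub>v v) $ j)"
      using v(1) k' by (intro sum.cong refl)
        (simp add: mat_vec_index[OF G1] G1_index gram_index[OF A])
    also have "\<dots> = 0" using v by simp
    finally have w0: "\<forall>i<n. w i = 0"
      by (simp add: sum_nonneg_eq_0_iff)
    have "v $ l = 0" if l: "l < k'" for l
    proof -
      have "v $ l = (\<Sum>j<k'. (if l = j then 1 else 0) * v $ j)"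
        using l by (simp add: if_distrib[of "\<lambda>x. x * _"] cong: if_cong)
      also have "\<dots> = (\<Sum>j<k'. (\<Sum>i<n. b l i * X n $$ (i, j)) * v $ j)"
        using l k' by (intro sum.cong refl) (simp add: weight_design)
      also have "\<dots> = (\<Sum>i<n. b l i * w i)"
        unfolding w_def sum_distrib_left sum_distrib_right
        by (subst sum.swap) (simp add: mult.assoc)
      finally show ?thesis using w0 by simp
    qed
    then show False using v by (auto intro!: eq_vecI)
  qed
  note I1 = adj_inv[OF G1 this]
  define u where "u = betaU X n Y $ k'"
  define c where "c = vec k' (\<lambda>j. betaU X n Y $ j - H $$ (j, k') / H $$ (k', k') * u)"
  have c: "c \<in> carrier_vec k'" by (simp add: c_def)
  have "G1 *\<^sub>v c = transpose_mat X1 *\<^sub>v vec n Y"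
  proof (rule eq_vecI)
    fix i assume "i < dim_vec (transpose_mat X1 *\<^sub>v vec n Y)"
    then have i: "i < k'" using X1 by simp
    have "(G1 *\<^sub>v c) $ i = (\<Sum>j<k'. G $$ (i, j) * (betaU X n Y $ j - H $$ (j, k') / H $$ (k', k') * u))"
      unfolding mat_vec_index[OF G1 c i] using i by (intro sum.cong refl) (simp add: c_def G1_index)
    \<comment> \<open>The added term j = k' is zero, its bracket being u - u.\<close>
    also have "\<dots> = (\<Sum>j<k. G $$ (i, j) * (betaU X n Y $ j - H $$ (j, k') / H $$ (k', k') * u))"
      using Hpos by (simp add: k'(2) u_def)
    also have "\<dots> = (\<Sum>j<k. G $$ (i, j) * betaU X n Y $ j) - (\<Sum>j<k. G $$ (i, j) * H $$ (j, k')) * (u / H $$ (k', k'))"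
      by (simp add: right_diff_distrib sum_subtractf sum_distrib_right sum_divide_distrib mult.assoc)
    also have "(\<Sum>j<k. G $$ (i, j) * H $$ (j, k')) = (G * H) $$ (i, k')"
      using i k' mat_mat_index[OF G H, of i k'] by simp
    also have "\<dots> = 0" unfolding GH using i k' by simp
    also have "(\<Sum>j<k. G $$ (i, j) * betaU X n Y $ j) = (\<Sum>l<n. X n $$ (l, i) * Y l)"
      using i k' by (intro normal_eq) simp
    also have "\<dots> = (transpose_mat X1 *\<^sub>v vec n Y) $ i"
      by (subst transpose_vec_index[OF X1 _ i]) (auto simp: X1_index i)
    finally show "(G1 *\<^sub>v c) $ i = (transpose_mat X1 *\<^sub>v vec n Y) $ i" by simp
  qed (use G1 X1 in auto)
  then have "mat_inv G1 *\<^sub>v (transpose_mat X1 *\<^sub>v vec n Y) = adj_inv G1 *\<^sub>v (G1 *\<^sub>v c)"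
    unfolding mat_inv_eqI[OF G1 I1] by simp
  also have "\<dots> = c"
    using assoc_mult_mat_vec[OF I1(1) G1 c] I1(3) c by simp
  finally have b1: "mat_inv G1 *\<^sub>v (transpose_mat X1 *\<^sub>v vec n Y) = c" .
  have "betaR X k k' n Y $ j = (if j < k' then c $ j else 0)"
    using j unfolding betaR_def Let_def X1_def[symmetric] G1_def[symmetric] b1 by simp
  also have "\<dots> = betaU X n Y $ j - H $$ (j, k') / H $$ (k', k') * u"
  proof (cases "j < k'")
    case False
    then have "j = k'" using j k' by simp
    then show ?thesis using Hpos by (simp add: u_def k'_def)
  qed (simp add: c_def)
  finally show ?thesis by (simp add: u_def k'_def)
qed

lemma betaR_carrier: "betaR X k (k - 1) n Y \<in> carrier_vec k"
  by (simp add: betaR_def Let_def)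

text \<open>The two fits differ by - u / h times the weight vector \<open>b (k - 1)\<close>, whose
  squared length is h. Divided by \<sigma>^2 this is the Wald statistic for a vanishing last
  coefficient.\<close>

lemma sqnorm_fit_diff:
  "sqnorm (X n *\<^sub>v betaR X k (k - 1) n Y - X n *\<^sub>v betaU X n Y)
    = (betaU X n Y $ (k - 1))\<^sup>2 / H $$ (k - 1, k - 1)"
proof -
  define u where "u = betaU X n Y $ (k - 1)"
  define h where "h = H $$ (k - 1, k - 1)"
  have h: "h > 0" using Hpos by (simp add: h_def)
  define d where "d = X n *\<^sub>v betaR X k (k - 1) n Y - X n *\<^sub>v betaU X n Y"
  have d: "d \<in> carrier_vec n" unfolding d_def
    using mult_mat_vec_carrier[OF A betaR_carrier] mult_mat_vec_carrier[OF A betaU_carrier] by auto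
  have di: "d $ i = - (u / h) * b (k - 1) i" if i: "i < n" for i
  proof -
    have "d $ i = (\<Sum>j<k. X n $$ (i, j) * betaR X k (k - 1) n Y $ j) - (\<Sum>j<k. X n $$ (i, j) * betaU X n Y $ j)"
      unfolding d_def mat_vec_index[OF A betaR_carrier i, symmetric] mat_vec_index[OF A betaU_carrier i, symmetric]
      using A i by simp
    also have "\<dots> = (\<Sum>j<k. - (u / h) * (H $$ (k - 1, j) * X n $$ (i, j)))"
      unfolding sum_subtractf[symmetric]
    proof (intro sum.cong refl)
      fix j assume "j \<in> {..<k}"
      then show "X n $$ (i, j) * betaR X k (k - 1) n Y $ j - X n $$ (i, j) * betaU X n Y $ j
         = - (u / h) * (H $$ (k - 1, j) * X n $$ (i, j))"
        using k by (simp add: betaR_index[unfolded One_nat_def] H_sym[of j "k - Suc 0"] algebra_simps u_def h_def)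
    qed
    finally show ?thesis by (simp add: b_eq sum_distrib_left)
  qed
  have "sqnorm d = (\<Sum>i<n. (d $ i)\<^sup>2)"
    using d by (simp add: sqnorm_def scalar_prod_def power2_eq_square atLeast0LessThan)
  also have "\<dots> = (\<Sum>i<n. (u / h)\<^sup>2 * (b (k - 1) i * b (k - 1) i))"
    using di by (intro sum.cong refl) (simp add: power2_eq_square)
  also have "\<dots> = (u / h)\<^sup>2 * h"
    using k by (simp add: weight_weight h_def flip: sum_distrib_left)
  also have "\<dots> = u\<^sup>2 / h" using h by (simp add: power2_eq_square)
  finally show ?thesis by (simp add: d_def u_def h_def)
qed

end

section \<open>Local parameters\<close>

declare One_nat_def [simp del]

definition local_par :: "nat \<Rightarrow> real vec \<Rightarrow> real \<Rightarrow> nat \<Rightarrow> real vec" where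
  "local_par k \<beta> g n = \<beta> + (g / sqrt (real n)) \<cdot>\<^sub>v unit_vec k (k - 1)"

lemma local_par_carrier: "\<beta> \<in> carrier_vec k \<Longrightarrow> local_par k \<beta> g n \<in> carrier_vec k"
  by (simp add: local_par_def)

lemma local_par_index:
  "\<beta> \<in> carrier_vec k \<Longrightarrow> j < k \<Longrightarrow>
    local_par k \<beta> g n $ j = \<beta> $ j + (if j = k - 1 then g / sqrt (real n) else 0)"
  by (simp add: local_par_def)

lemma local_par_0: "\<beta> \<in> carrier_vec k \<Longrightarrow> local_par k \<beta> 0 n = \<beta>"
  by (rule eq_vecI) (auto simp: local_par_def)

lemma local_par_nbhd:
  assumes b: "\<beta> \<in> carrier_vec k" and n: "0 < n" and k: "0 < k" and g: "\<bar>g\<bar> < \<rho>"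
  shows "local_par k \<beta> g n \<in> nbhd k \<beta> \<rho> n"
proof -
  have c: "local_par k \<beta> g n - \<beta> \<in> carrier_vec k" using b by (simp add: local_par_def)
  have "sqnorm v = (\<Sum>j<k. (v $ j)\<^sup>2)" if "v \<in> carrier_vec k" for v
    using that by (simp add: sqnorm_def scalar_prod_def power2_eq_square atLeast0LessThan)
  from this[OF c] have "sqnorm (local_par k \<beta> g n - \<beta>) = (\<Sum>j<k. ((local_par k \<beta> g n - \<beta>) $ j)\<^sup>2)" .
  also have "\<dots> = (\<Sum>j<k. if j = k - 1 then (g / sqrt (real n))\<^sup>2 else 0)"
    using b by (intro sum.cong refl) (simp add: local_par_index)
  also have "\<dots> = (g / sqrt (real n))\<^sup>2" using k by simp
  finally have "sqrt (sqnorm (local_par k \<beta> g n - \<beta>)) = \<bar>g\<bar> / sqrt (real n)"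
    by (simp only: real_sqrt_abs) simp
  then show ?thesis
    using n g local_par_carrier[OF b] by (simp add: nbhd_def divide_strict_right_mono)
qed

section \<open>The distribution function under local parameters\<close>

context design_matrix
begin

text \<open>With y the noise, \<open>U j y\<close> is sqrt n times the error of the j-th least
  squares estimate. \<open>rat_H j\<close> measures how far the restriction moves coordinate j, and
  \<open>rate\<close> is the finite-sample counterpart of \<alpha> Q_kk / \<sigma>^2.\<close>

abbreviation "U j y \<equiv> (\<Sum>i<n. (sqrt (real n) * b j i) * y i)"
abbreviation "P0 \<sigma> \<equiv> gauss \<sigma> n (\<lambda>_. 0)"
abbreviation "rat_H j \<equiv> H $$ (j, k - 1) / H $$ (k - 1, k - 1)"
abbreviation "rate \<sigma> \<alpha> \<equiv> \<alpha> / (\<sigma>\<^sup>2 * (real n * H $$ (k - 1, k - 1)))"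

lemma U_variance: "j < k \<Longrightarrow> (\<Sum>i<n. (sqrt (real n) * b j i)\<^sup>2) = real n * H $$ (j, j)"
proof -
  assume "j < k"
  then have "(\<Sum>i<n. (b j i)\<^sup>2) = H $$ (j, j)"
    using weight_weight[of j j] by (simp add: power2_eq_square)
  then show ?thesis
    by (simp add: power_mult_distrib sum_distrib_left[symmetric])
qed

lemma weights_of_mean:
  assumes "\<theta> \<in> carrier_vec k" "j < k"
  shows "(\<Sum>i<n. b j i * (X n *\<^sub>v \<theta>) $ i) = \<theta> $ j"
proof -
  have "(\<Sum>i<n. b j i * (X n *\<^sub>v \<theta>) $ i) = (\<Sum>i<n. \<Sum>l<k. b j i * X n $$ (i, l) * \<theta> $ l)"
    by (intro sum.cong refl, subst mat_vec_index[OF A assms(1)]) (auto simp: sum_distrib_left mult.assoc)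
  also have "\<dots> = (\<Sum>l<k. (\<Sum>i<n. b j i * X n $$ (i, l)) * \<theta> $ l)"
    by (subst sum.swap) (simp add: sum_distrib_right)
  also have "\<dots> = (\<Sum>l<k. (if j = l then 1 else 0) * \<theta> $ l)"
    using assms(2) by (intro sum.cong refl) (simp add: weight_design)
  also have "\<dots> = \<theta> $ j"
    using assms(2) by (simp add: if_distrib[of "\<lambda>x. x * _"] cong: if_cong)
  finally show ?thesis .
qed

lemma beta_tilde_index:
  assumes n: "0 < n" and j: "j < k"
  shows "beta_tilde X k (k - 1) \<sigma> \<alpha> n Y $ j = (\<Sum>i<n. b j i * Y i)
    - rat_H j * (wgt (exp (-2 * \<alpha>)) (rate \<sigma> \<alpha>) (sqrt (real n) * (\<Sum>i<n. b (k - 1) i * Y i))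
        * (\<Sum>i<n. b (k - 1) i * Y i))"
proof -
  define u where "u = (\<Sum>i<n. b (k - 1) i * Y i)"
  define l where "l = lambda_hat X k (k - 1) \<sigma> \<alpha> n Y"
  have k1: "k - 1 < k" using k by simp
  have "\<alpha> * (u\<^sup>2 / H $$ (k - 1, k - 1)) / \<sigma>\<^sup>2 = rate \<sigma> \<alpha> * (sqrt (real n) * u)\<^sup>2"
    using n Hpos by (simp add: power_mult_distrib)
  moreover have "real (k - (k - 1)) = 1" using k by simp
  ultimately have l: "l = wgt (exp (-2 * \<alpha>)) (rate \<sigma> \<alpha>) (sqrt (real n) * u)"
    unfolding l_def lambda_hat_def wgt_def sqnorm_fit_diff betaU_index[OF k1] u_def[symmetric] by simp
  have "beta_tilde X k (k - 1) \<sigma> \<alpha> n Y $ j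
     = l * betaR X k (k - 1) n Y $ j + (1 - l) * betaU X n Y $ j"
    unfolding beta_tilde_def l_def[symmetric] using j carrier_vecD[OF betaU_carrier[of Y]] carrier_vecD[OF betaR_carrier[of Y]]
    by simp
  also have "\<dots> = betaU X n Y $ j - rat_H j * (l * u)"
    unfolding betaR_index[OF j] betaU_index[OF k1] u_def[symmetric] by (simp add: algebra_simps)
  finally show ?thesis
    unfolding betaU_index[OF j] l u_def .
qed

text \<open>Subtracting the parameter removes \<beta> from the linear part, and the weight sees only
  the last coordinate, which is g / sqrt n because \<open>\<beta> $ (k - 1) = 0\<close>. The right
  side is free of \<beta>, which makes the later bounds uniform in it.\<close>

lemma Fdist_local_par:
  assumes n: "0 < n" and s: "0 < \<sigma>" and b: "\<beta> \<in> carrier_vec k" "\<beta> $ (k - 1) = 0"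
  shows "Fdist X k (k - 1) \<sigma> \<alpha> t n (local_par k \<beta> g n) =
    measure (P0 \<sigma>) {y \<in> space (P0 \<sigma>). \<forall>j<k. U j y
      - rat_H j * (wgt (exp (-2 * \<alpha>)) (rate \<sigma> \<alpha>) (U (k - 1) y + g) * (U (k - 1) y + g)) \<le> t $ j}"
proof -
  define \<theta> where "\<theta> = local_par k \<beta> g n"
  have th: "\<theta> \<in> carrier_vec k" using b by (simp add: \<theta>_def local_par_carrier)
  define \<mu> where "\<mu> i = (X n *\<^sub>v \<theta>) $ i" for i
  have k1: "k - 1 < k" using k by simp
  have thk: "\<theta> $ (k - 1) = g / sqrt (real n)"
    unfolding \<theta>_def using local_par_index[OF b(1) k1] b(2) by simp
  \<comment> \<open>The event is restated through the explicit formula for the estimator, from which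
    measurability is immediate.\<close>
  define A where "A = {Y \<in> space (PiM {..<n} (\<lambda>_. borel :: real measure)). \<forall>j<k. sqrt (real n) * (((\<Sum>i<n. b j i * Y i)
    - rat_H j * (wgt (exp (-2 * \<alpha>)) (rate \<sigma> \<alpha>) (sqrt (real n) * (\<Sum>i<n. b (k - 1) i * Y i))
        * (\<Sum>i<n. b (k - 1) i * Y i))) - \<theta> $ j) \<le> t $ j}"
  have A: "A \<in> sets (PiM {..<n} (\<lambda>_. borel))" unfolding A_def by measurable
  have sp: "space (gauss \<sigma> n \<nu>) = space (PiM {..<n} (\<lambda>_. borel :: real measure))" for \<nu>
    by (simp add: space_gauss space_PiM)
  have "Fdist X k (k - 1) \<sigma> \<alpha> t n \<theta> = measure (gauss \<sigma> n \<mu>) A"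
    unfolding Fdist_def distrY_eq_gauss \<mu>_def[symmetric] A_def sp
    by (intro arg_cong2[where f = measure] refl Collect_cong conj_cong all_cong1 imp_cong)
       (simp add: beta_tilde_index[OF n])
  also have "\<dots> = measure (P0 \<sigma>) {y \<in> space (P0 \<sigma>). (\<lambda>i\<in>{..<n}. y i + \<mu> i) \<in> A}"
    by (rule measure_gauss_translate[OF s A])
  also have "{y \<in> space (P0 \<sigma>). (\<lambda>i\<in>{..<n}. y i + \<mu> i) \<in> A} = {y \<in> space (P0 \<sigma>). \<forall>j<k. U j y
      - rat_H j * (wgt (exp (-2 * \<alpha>)) (rate \<sigma> \<alpha>) (U (k - 1) y + g) * (U (k - 1) y + g)) \<le> t $ j}"
  proof (intro Collect_cong conj_cong refl)
    fix y assume "y \<in> space (P0 \<sigma>)"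
    have S: "(\<Sum>i<n. b j i * (\<lambda>i\<in>{..<n}. y i + \<mu> i) i) = (\<Sum>i<n. b j i * y i) + \<theta> $ j" if "j < k" for j
      using weights_of_mean[OF th that] by (simp add: \<mu>_def distrib_left sum.distrib)
    have Sk: "sqrt (real n) * ((\<Sum>i<n. b (k - 1) i * y i) + \<theta> $ (k - 1)) = U (k - 1) y + g"
      using n by (simp add: thk distrib_left sum_distrib_left mult.assoc)
    have rsp: "(\<lambda>i\<in>{..<n}. y i + \<mu> i) \<in> space (PiM {..<n} (\<lambda>_. borel :: real measure))"
      by (simp add: space_PiM)
    have E: "sqrt (real n) * ((((\<Sum>i<n. b j i * y i) + \<theta> $ j) - rat_H j * (w * ((\<Sum>i<n. b (k - 1) i * y i) + \<theta> $ (k - 1)))) - \<theta> $ j)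
       = U j y - rat_H j * (w * (U (k - 1) y + g))" for j w
    proof -
      have "sqrt (real n) * ((((\<Sum>i<n. b j i * y i) + \<theta> $ j) - rat_H j * (w * ((\<Sum>i<n. b (k - 1) i * y i) + \<theta> $ (k - 1)))) - \<theta> $ j)
        = sqrt (real n) * (\<Sum>i<n. b j i * y i) - rat_H j * (w * (sqrt (real n) * ((\<Sum>i<n. b (k - 1) i * y i) + \<theta> $ (k - 1))))"
        by (simp add: right_diff_distrib)
      then show ?thesis unfolding Sk by (simp add: sum_distrib_left mult.assoc)
    qed
    show "((\<lambda>i\<in>{..<n}. y i + \<mu> i) \<in> A) = (\<forall>j<k. U j y
      - rat_H j * (wgt (exp (-2 * \<alpha>)) (rate \<sigma> \<alpha>) (U (k - 1) y + g) * (U (k - 1) y + g)) \<le> t $ j)"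
      unfolding A_def mem_Collect_eq S[OF k1] Sk
      by (simp only: rsp S E simp_thms cong: imp_cong)
  qed
  finally show ?thesis unfolding \<theta>_def .
qed

text \<open>Shifting the mean of the first coordinates by a large multiple of \<open>-1\<close> makes the
  constraint on them almost vacuous without changing the law of the last coordinate, and by
  the chi-square bound such a shift costs at most a constant factor.\<close>

lemma window_lower:
  assumes n: "0 < n" and s: "0 < \<sigma>" and M: "\<And>j. j < k - 1 \<Longrightarrow> 0 < \<tau> j + M" and p0: "0 \<le> p"
    and p: "p \<le> measure (P0 \<sigma>) {y \<in> space (P0 \<sigma>). e1 < U (k - 1) y \<and> U (k - 1) y \<le> e2}"
    and tail: "(\<Sum>j<k - 1. \<sigma>\<^sup>2 * (real n * H $$ (j, j)) / (\<tau> j + M)\<^sup>2) \<le> p / 2"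
    and S: "M\<^sup>2 * (\<Sum>l<k - 1. \<Sum>m<k - 1. G $$ (l, m) / real n) / \<sigma>\<^sup>2 \<le> S"
  shows "(p / (2 * (1 + sqrt (exp S - 1))))\<^sup>2 \<le>
    measure (P0 \<sigma>) {y \<in> space (P0 \<sigma>). (\<forall>j<k - 1. U j y \<le> \<tau> j) \<and> e1 < U (k - 1) y \<and> U (k - 1) y \<le> e2}"
proof -
  define \<theta> where "\<theta> = vec k (\<lambda>j. if j < k - 1 then - M / sqrt (real n) else 0)"
  have th: "\<theta> \<in> carrier_vec k" by (simp add: \<theta>_def)
  define \<mu> where "\<mu> i = (X n *\<^sub>v \<theta>) $ i" for i
  interpret prob_space "P0 \<sigma>" by (rule prob_space_gauss[OF s])
  have sp: "space (gauss \<sigma> n \<nu>) = space (PiM {..<n} (\<lambda>_. borel :: real measure))" for \<nu>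
    by (simp add: space_gauss space_PiM)
  define B where "B = {y \<in> space (P0 \<sigma>). (\<forall>j<k - 1. U j y \<le> \<tau> j) \<and> e1 < U (k - 1) y \<and> U (k - 1) y \<le> e2}"
  define W where "W = {y \<in> space (P0 \<sigma>). e1 < U (k - 1) y \<and> U (k - 1) y \<le> e2}"
  define T where "T j = {y \<in> space (P0 \<sigma>). \<tau> j + M < U j y}" for j
  define C where "C = {y \<in> space (P0 \<sigma>). (\<lambda>i\<in>{..<n}. y i + \<mu> i) \<in> B}"
  have Bs: "B \<in> sets (P0 \<sigma>)" unfolding B_def by measurable
  have Bs': "B \<in> sets (PiM {..<n} (\<lambda>_. borel))" using Bs by (simp add: sets_gauss)
  have Ts: "T j \<in> events" for j unfolding T_def by measurable
  have Ws: "W \<in> events" unfolding W_def by measurable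
  have shift: "U j (\<lambda>i\<in>{..<n}. y i + \<mu> i) = U j y + (if j < k - 1 then - M else 0)" if j: "j < k" for j y
  proof -
    have "U j (\<lambda>i\<in>{..<n}. y i + \<mu> i) = U j y + sqrt (real n) * (\<Sum>i<n. b j i * \<mu> i)"
      by (simp add: distrib_left sum.distrib sum_distrib_left mult.assoc)
    also have "(\<Sum>i<n. b j i * \<mu> i) = \<theta> $ j" unfolding \<mu>_def by (rule weights_of_mean[OF th j])
    finally show ?thesis using j n by (simp add: \<theta>_def)
  qed
  have Ceq: "C = {y \<in> space (P0 \<sigma>). (\<forall>j<k - 1. U j y \<le> \<tau> j + M) \<and> e1 < U (k - 1) y \<and> U (k - 1) y \<le> e2}"
  proof -
    have "(\<lambda>i\<in>{..<n}. y i + \<mu> i) \<in> space (P0 \<sigma>)" for y by (simp add: space_gauss)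
    moreover have "k - 1 < k" using k by simp
    moreover have "U j (\<lambda>i\<in>{..<n}. y i + \<mu> i) \<le> \<tau> j \<longleftrightarrow> U j y \<le> \<tau> j + M" if "j < k - 1" for j y
    proof -
      have "U j (\<lambda>i\<in>{..<n}. y i + \<mu> i) = U j y - M" using shift[of j y] that by simp
      then show ?thesis by (simp only: diff_le_eq)
    qed
    ultimately show ?thesis unfolding C_def B_def mem_Collect_eq using shift[of "k - 1"] by (simp cong: conj_cong)
  qed
  have Cs: "C \<in> events" unfolding Ceq by measurable
  \<comment> \<open>With the relaxed bounds the constraints fail only on the tails
    \<open>T j\<close>, which take at most half of p.\<close>
  have "W \<subseteq> C \<union> (\<Union>j<k - 1. T j)" unfolding W_def Ceq T_def by (auto simp: not_le)
  then have "prob W \<le> prob (C \<union> (\<Union>j<k - 1. T j))"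
    using Cs Ts by (intro finite_measure_mono) auto
  also have "\<dots> \<le> prob C + prob (\<Union>j<k - 1. T j)"
    using Cs Ts by (intro measure_Un_le) auto
  also have "prob (\<Union>j<k - 1. T j) \<le> (\<Sum>j<k - 1. prob (T j))"
    using Ts by (intro finite_measure_subadditive_finite) auto
  also have "\<dots> \<le> (\<Sum>j<k - 1. \<sigma>\<^sup>2 * (real n * H $$ (j, j)) / (\<tau> j + M)\<^sup>2)"
  proof (rule sum_mono)
    fix j assume j: "j \<in> {..<k - 1}"
    then have jk: "j < k" by simp
    have "0 < (\<Sum>i<n. (sqrt (real n) * b j i)\<^sup>2)" unfolding U_variance[OF jk] using n Hdiag[OF jk] by simp
    from gauss_linear_tail[OF s this, of "\<tau> j + M"] M[of j] j
    show "prob (T j) \<le> \<sigma>\<^sup>2 * (real n * H $$ (j, j)) / (\<tau> j + M)\<^sup>2"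
      unfolding T_def U_variance[OF jk] by simp
  qed
  also have "\<dots> \<le> p / 2" by (rule tail)
  finally have "p / 2 \<le> prob C" using p unfolding W_def by linarith
  also have "prob C = measure (gauss \<sigma> n \<mu>) B"
    unfolding C_def by (rule measure_gauss_translate[OF s Bs', symmetric])
  also have "\<dots> \<le> prob B + sqrt (exp ((\<Sum>i<n. (\<mu> i - 0)\<^sup>2) / \<sigma>\<^sup>2) - 1) * sqrt (prob B)"
    by (rule gauss_chi_square[OF s Bs])
  \<comment> \<open>A probability is at most its root, so both terms become multiples of sqrt (prob
    B); solving for it explains the square in the claim.\<close>
  also have "\<dots> \<le> sqrt (prob B) + sqrt (exp S - 1) * sqrt (prob B)"
  proof (intro add_mono mult_right_mono real_sqrt_le_mono diff_mono order_refl)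
    show "prob B \<le> sqrt (prob B)"
      by (rule real_le_rsqrt) (simp add: power2_eq_square mult_left_le)
    have "(\<Sum>i<n. (\<mu> i - 0)\<^sup>2) = (\<Sum>i<n. (\<Sum>l<k - 1. X n $$ (i, l) * (- M / sqrt (real n)))\<^sup>2)"
    proof (intro sum.cong refl)
      fix i assume "i \<in> {..<n}"
      then have "\<mu> i = (\<Sum>l<k. X n $$ (i, l) * \<theta> $ l)"
        unfolding \<mu>_def using mat_vec_index[OF A th] by simp
      also have "\<dots> = (\<Sum>l<k - 1. X n $$ (i, l) * \<theta> $ l)"
        by (rule sum.mono_neutral_right) (use k in \<open>auto simp: \<theta>_def\<close>)
      also have "\<dots> = (\<Sum>l<k - 1. X n $$ (i, l) * (- M / sqrt (real n)))"
        by (intro sum.cong refl) (auto simp: \<theta>_def)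
      finally show "(\<mu> i - 0)\<^sup>2 = (\<Sum>l<k - 1. X n $$ (i, l) * (- M / sqrt (real n)))\<^sup>2" by simp
    qed
    also have "\<dots> = (\<Sum>i<n. \<Sum>l<k - 1. \<Sum>m<k - 1. M\<^sup>2 * (X n $$ (i, l) * X n $$ (i, m) / real n))"
      by (intro sum.cong refl, unfold power2_eq_square sum_product, intro sum.cong refl)
         (simp add: field_simps)
    also have "\<dots> = (\<Sum>l<k - 1. \<Sum>m<k - 1. \<Sum>i<n. M\<^sup>2 * (X n $$ (i, l) * X n $$ (i, m) / real n))"
      by (rule trans[OF sum.swap]) (rule sum.cong[OF refl sum.swap])
    also have "\<dots> = M\<^sup>2 * (\<Sum>l<k - 1. \<Sum>m<k - 1. G $$ (l, m) / real n)"
      unfolding sum_distrib_left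
      by (intro sum.cong refl) (simp add: gram_index[OF A] sum_distrib_left sum_divide_distrib)
    finally show "exp ((\<Sum>i<n. (\<mu> i - 0)\<^sup>2) / \<sigma>\<^sup>2) \<le> exp S" using S by simp
  qed simp
  also have "\<dots> = (1 + sqrt (exp S - 1)) * sqrt (prob B)" by (simp add: algebra_simps)
  finally have main: "p / 2 \<le> (1 + sqrt (exp S - 1)) * sqrt (prob B)" .
  \<comment> \<open>The double sum is a sum of squares, so S is non-negative and the divisor in the
    claim is positive.\<close>
  have "0 \<le> (\<Sum>l<k - 1. \<Sum>m<k - 1. G $$ (l, m) / real n)"
  proof -
    have "(\<Sum>l<k - 1. \<Sum>m<k - 1. G $$ (l, m) / real n)
      = (\<Sum>l<k - 1. \<Sum>m<k - 1. \<Sum>i<n. X n $$ (i, l) * X n $$ (i, m) / real n)"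
      by (intro sum.cong refl) (simp add: gram_index[OF A] sum_divide_distrib)
    also have "\<dots> = (\<Sum>i<n. \<Sum>l<k - 1. \<Sum>m<k - 1. X n $$ (i, l) * X n $$ (i, m) / real n)"
      by (rule sym, rule trans[OF sum.swap]) (rule sum.cong[OF refl sum.swap])
    also have "\<dots> = (\<Sum>i<n. (\<Sum>l<k - 1. X n $$ (i, l))\<^sup>2 / real n)"
      by (simp add: power2_eq_square sum_product sum_divide_distrib)
    also have "\<dots> \<ge> 0" by (intro sum_nonneg) auto
    finally show ?thesis .
  qed
  then have "0 \<le> S" using S by (smt (verit) divide_nonneg_nonneg mult_nonneg_nonneg zero_le_power2)
  then have pos: "0 < 1 + sqrt (exp S - 1)" by (simp add: add_pos_nonneg)
  have "p / (2 * (1 + sqrt (exp S - 1))) \<le> sqrt (prob B)"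
    using main pos by (simp add: pos_divide_le_eq) (simp add: algebra_simps)
  then have "(p / (2 * (1 + sqrt (exp S - 1))))\<^sup>2 \<le> (sqrt (prob B))\<^sup>2"
    using p0 pos by (intro power_mono) auto
  then show ?thesis by (simp add: B_def)
qed

text \<open>The cut of g lies below e1 and that of g' is at least e2. The window set is therefore
  disjoint from the event of g, and both lie in the event of g' except where some \<open>U j\<close>
  is within \<epsilon> of its bound. Anti-concentration prices these strips.\<close>

lemma Fdist_gap:
  assumes n: "0 < n" and s: "0 < \<sigma>" and al: "0 < \<alpha>" and b: "\<beta> \<in> carrier_vec k" "\<beta> $ (k - 1) = 0"
    and e: "e1 \<le> e2"
    and c1: "t $ (k - 1) + g < shrink (exp (-2 * \<alpha>)) (rate \<sigma> \<alpha>) (e1 + g)"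
    and c2: "shrink (exp (-2 * \<alpha>)) (rate \<sigma> \<alpha>) (e2 + g') \<le> t $ (k - 1) + g'"
    and r: "\<And>j. j < k - 1 \<Longrightarrow> \<bar>rat_H j\<bar> * ((1 + 1 / rate \<sigma> \<alpha>) / exp (-2 * \<alpha>)) \<le> \<epsilon>"
    and eps: "0 \<le> \<epsilon>"
  shows "Fdist X k (k - 1) \<sigma> \<alpha> t n (local_par k \<beta> g n)
     + measure (P0 \<sigma>) {y \<in> space (P0 \<sigma>). (\<forall>j<k - 1. U j y \<le> t $ j) \<and> e1 < U (k - 1) y \<and> U (k - 1) y \<le> e2}
     \<le> Fdist X k (k - 1) \<sigma> \<alpha> t n (local_par k \<beta> g' n)
     + (\<Sum>j<k - 1. 2 * \<epsilon> / (\<sigma> * sqrt (real n * H $$ (j, j))))"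
proof -
  interpret prob_space "P0 \<sigma>" by (rule prob_space_gauss[OF s])
  define c where "c = exp (-2 * \<alpha>)"
  define a where "a = rate \<sigma> \<alpha>"
  have c: "0 < c" by (simp add: c_def)
  have a: "0 < a" using al s n Hpos by (simp add: a_def)
  have k1: "k - 1 < k" using k by simp
  define corr where "corr g j y = rat_H j * (wgt c a (U (k - 1) y + g) * (U (k - 1) y + g))" for g j y
  define E where "E g = {y \<in> space (P0 \<sigma>). \<forall>j<k. U j y - corr g j y \<le> t $ j}" for g
  define B where "B = {y \<in> space (P0 \<sigma>). (\<forall>j<k - 1. U j y \<le> t $ j) \<and> e1 < U (k - 1) y \<and> U (k - 1) y \<le> e2}"
  define N where "N j = {y \<in> space (P0 \<sigma>). \<bar>U j y - t $ j\<bar> \<le> \<epsilon>}" for j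
  have Es: "E g \<in> events" for g unfolding E_def corr_def by measurable
  have Bs: "B \<in> events" unfolding B_def by measurable
  have Ns: "N j \<in> events" for j unfolding N_def by measurable
  have F: "Fdist X k (k - 1) \<sigma> \<alpha> t n (local_par k \<beta> g n) = prob (E g)" for g
    unfolding Fdist_local_par[OF n s b] E_def corr_def c_def a_def ..
  have corr: "\<bar>corr g j y\<bar> \<le> \<epsilon>" if "j < k - 1" for g j y
  proof -
    have "\<bar>corr g j y\<bar> \<le> \<bar>rat_H j\<bar> * ((1 + 1 / a) / c)"
      unfolding corr_def abs_mult[of "rat_H j"] by (intro mult_left_mono wgt_mult_bound c a) auto
    then show ?thesis using r[OF that] by (simp add: a_def c_def)
  qed
  have last: "U (k - 1) y - corr g (k - 1) y = shrink c a (U (k - 1) y + g) - g" for g y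
  proof -
    have 1: "rat_H (k - 1) = 1" using Hpos by simp
    have "u - 1 * (w * (u + g)) = (u + g) * (1 - w) - g" for u w :: real by (simp add: algebra_simps)
    then show ?thesis unfolding corr_def shrink_def 1 .
  qed
  have Eiff: "y \<in> E g \<longleftrightarrow> y \<in> space (P0 \<sigma>) \<and> (\<forall>j<k - 1. U j y - corr g j y \<le> t $ j)
      \<and> shrink c a (U (k - 1) y + g) \<le> t $ (k - 1) + g" for g y
  proof -
    have "(\<forall>j<k. Q j) \<longleftrightarrow> (\<forall>j<k - 1. Q j) \<and> Q (k - 1)" for Q
      using k by (cases k) (auto simp: less_Suc_eq)
    from this[of "\<lambda>j. U j y - corr g j y \<le> t $ j"] show ?thesis
      unfolding E_def mem_Collect_eq last by (simp add: diff_le_eq)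
  qed
  have Eg_le: "U (k - 1) y \<le> e1" if "y \<in> E g" for y
  proof (rule ccontr)
    assume "\<not> U (k - 1) y \<le> e1"
    then have "shrink c a (e1 + g) \<le> shrink c a (U (k - 1) y + g)"
      by (intro shrink_mono c a) simp
    then show False using that c1 unfolding Eiff c_def a_def by linarith
  qed
  have sub: "E g \<union> B \<subseteq> E g' \<union> (\<Union>j<k - 1. N j)"
  proof
    fix y assume y: "y \<in> E g \<union> B"
    then have sp: "y \<in> space (P0 \<sigma>)" by (auto simp: E_def B_def)
    have "U (k - 1) y \<le> e2" using y Eg_le[of y] e by (auto simp: B_def)
    then have "shrink c a (U (k - 1) y + g') \<le> shrink c a (e2 + g')"
      by (intro shrink_mono c a) simp
    then have 1: "shrink c a (U (k - 1) y + g') \<le> t $ (k - 1) + g'"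
      using c2 unfolding c_def a_def by linarith
    have 2: "U j y \<le> t $ j + \<epsilon>" if j: "j < k - 1" for j
    proof (cases "y \<in> B")
      case True
      then show ?thesis using j eps unfolding B_def by fastforce
    next
      case False
      then have "y \<in> E g" using y by blast
      then have "U j y - corr g j y \<le> t $ j" using j unfolding Eiff by blast
      then show ?thesis using corr[OF j, of g y] by linarith
    qed
    show "y \<in> E g' \<union> (\<Union>j<k - 1. N j)"
    proof (cases "y \<in> (\<Union>j<k - 1. N j)")
      case False
      \<comment> \<open>Outside the strip, U j \<le> t_j + \<epsilon> sharpens to U j < t_j -
        \<epsilon>, which leaves room for the correction under g'.\<close>
      have "U j y - corr g' j y \<le> t $ j" if j: "j < k - 1" for j
      proof -
        have "y \<notin> N j" using False j by blast
        then have "\<not> \<bar>U j y - t $ j\<bar> \<le> \<epsilon>" using sp by (simp add: N_def)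
        then show ?thesis using 2[OF j] corr[OF j, of g' y] by linarith
      qed
      then show ?thesis using sp 1 unfolding Un_iff Eiff by blast
    qed blast
  qed
  have disj: "E g \<inter> B = {}" using Eg_le by (force simp: B_def)
  have "prob (E g) + prob B = prob (E g \<union> B)"
    using disj Es Bs by (simp add: finite_measure_Union)
  also have "\<dots> \<le> prob (E g' \<union> (\<Union>j<k - 1. N j))"
    using sub Es Ns by (intro finite_measure_mono) auto
  also have "\<dots> \<le> prob (E g') + prob (\<Union>j<k - 1. N j)"
    using Es Ns by (intro measure_Un_le) auto
  also have "prob (\<Union>j<k - 1. N j) \<le> (\<Sum>j<k - 1. prob (N j))"
    using Ns by (intro finite_measure_subadditive_finite) auto
  also have "\<dots> \<le> (\<Sum>j<k - 1. 2 * \<epsilon> / (\<sigma> * sqrt (real n * H $$ (j, j))))"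
  proof (rule sum_mono)
    fix j assume j: "j \<in> {..<k - 1}"
    then have jk: "j < k" by simp
    have "0 < (\<Sum>i<n. (sqrt (real n) * b j i)\<^sup>2)" unfolding U_variance[OF jk] using n Hdiag[OF jk] by simp
    from gauss_linear_near[OF s this eps]
    show "prob (N j) \<le> 2 * \<epsilon> / (\<sigma> * sqrt (real n * H $$ (j, j)))"
      unfolding N_def U_variance[OF jk] .
  qed
  finally show ?thesis unfolding F B_def by simp
qed

end

section \<open>Asymptotics and lower bounds\<close>

lemma err_prob_le_1: "0 < \<sigma> \<Longrightarrow> err_prob X k k1 \<sigma> \<alpha> t n \<theta> h \<delta> \<le> 1"
  unfolding err_prob_def distrY_eq_gauss by (rule prob_space.prob_le_1[OF prob_space_gauss])

lemma err_prob_nonneg: "0 \<le> err_prob X k k1 \<sigma> \<alpha> t n \<theta> h \<delta>"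
  by (simp add: err_prob_def)

text \<open>As the targets differ by more than 2 \<delta>, an estimate within \<delta> of the target
  at \<theta>' errs by more than \<delta> at \<theta>. The chi-square bound carries the probability
  of this success event from \<theta>' to \<theta>.\<close>

lemma err_prob_two_point:
  assumes s: "0 < \<sigma>" and h: "h \<in> estimators n"
    and F: "2 * \<delta> < \<bar>Fdist X k k1 \<sigma> \<alpha> t n \<theta>' - Fdist X k k1 \<sigma> \<alpha> t n \<theta>\<bar>"
  shows "1 \<le> err_prob X k k1 \<sigma> \<alpha> t n \<theta>' h \<delta> + err_prob X k k1 \<sigma> \<alpha> t n \<theta> h \<delta>
    + sqrt (exp ((\<Sum>i<n. ((X n *\<^sub>v \<theta>') $ i - (X n *\<^sub>v \<theta>) $ i)\<^sup>2) / \<sigma>\<^sup>2) - 1)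
      * sqrt (err_prob X k k1 \<sigma> \<alpha> t n \<theta> h \<delta>)"
proof -
  define \<mu> where "\<mu> i = (X n *\<^sub>v \<theta>) $ i" for i
  define \<nu> where "\<nu> i = (X n *\<^sub>v \<theta>') $ i" for i
  define f where "f = Fdist X k k1 \<sigma> \<alpha> t n \<theta>"
  define f' where "f' = Fdist X k k1 \<sigma> \<alpha> t n \<theta>'"
  define \<tau> where "\<tau> = sqrt (exp ((\<Sum>i<n. (\<nu> i - \<mu> i)\<^sup>2) / \<sigma>\<^sup>2) - 1)"
  have \<tau>0: "0 \<le> \<tau>" using s by (simp add: \<tau>_def sum_nonneg)
  have so: "sets (obs_space n) = sets (PiM {..<n} (\<lambda>_. borel))"
    unfolding obs_space_def by (rule sets_PiM_cong) auto
  have hm: "h \<in> borel_measurable (gauss \<sigma> n \<kappa>)" for \<kappa>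
    using h measurable_cong_sets[OF trans[OF so sets_gauss[symmetric, where \<sigma> = \<sigma> and \<mu> = \<kappa>]] refl]
    unfolding estimators_def by blast
  note [measurable] = hm
  define A where "A = {Y \<in> space (gauss \<sigma> n \<mu>). \<bar>h Y - f'\<bar> \<le> \<delta>}"
  define E where "E = {Y \<in> space (gauss \<sigma> n \<mu>). \<bar>h Y - f\<bar> > \<delta>}"
  have As: "A \<in> sets (gauss \<sigma> n \<mu>)" unfolding A_def by measurable
  have Es: "E \<in> sets (gauss \<sigma> n \<mu>)" unfolding E_def by measurable
  interpret P: prob_space "gauss \<sigma> n \<mu>" by (rule prob_space_gauss[OF s])
  interpret P': prob_space "gauss \<sigma> n \<nu>" by (rule prob_space_gauss[OF s])
  have sp: "space (gauss \<sigma> n \<mu>) = space (gauss \<sigma> n \<nu>)" by (simp add: space_gauss)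
  have As': "A \<in> sets (gauss \<sigma> n \<nu>)" using As by (simp add: sets_gauss)
  have err: "err_prob X k k1 \<sigma> \<alpha> t n \<theta> h \<delta> = P.prob E"
    unfolding err_prob_def distrY_eq_gauss \<mu>_def[symmetric] f_def[symmetric] E_def ..
  have err': "err_prob X k k1 \<sigma> \<alpha> t n \<theta>' h \<delta> = P'.prob (space (gauss \<sigma> n \<nu>) - A)"
    unfolding err_prob_def distrY_eq_gauss \<nu>_def[symmetric] f'_def[symmetric] A_def sp
    by (intro arg_cong2[where f = measure] refl) auto
  have "A \<subseteq> E"
    using F unfolding A_def E_def f_def[symmetric] f'_def[symmetric] by auto
  then have AE: "P.prob A \<le> P.prob E" using Es by (intro P.finite_measure_mono) auto
  have "1 - P'.prob (space (gauss \<sigma> n \<nu>) - A) = P'.prob A" using P'.prob_compl[OF As'] by simp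
  also have "\<dots> \<le> P.prob A + \<tau> * sqrt (P.prob A)"
    unfolding \<tau>_def by (rule gauss_chi_square[OF s As])
  also have "\<dots> \<le> P.prob E + \<tau> * sqrt (P.prob E)"
    using AE \<tau>0 by (intro add_mono mult_left_mono real_sqrt_le_mono) auto
  finally show ?thesis
    unfolding err err' \<tau>_def \<mu>_def \<nu>_def by linarith
qed

text \<open>The means differ by a multiple of the last design column, so their distance is governed
  by one Gram entry; its quotient by n converges, which keeps the laws comparable as n
  grows.\<close>

lemma local_par_mean_dist:
  assumes A: "X n \<in> carrier_mat n k" and b: "\<beta> \<in> carrier_vec k" and n: "0 < n" and k: "0 < k"
  shows "(\<Sum>i<n. ((X n *\<^sub>v local_par k \<beta> g' n) $ i - (X n *\<^sub>v local_par k \<beta> g n) $ i)\<^sup>2)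
    = (g' - g)\<^sup>2 * ((transpose_mat (X n) * X n) $$ (k - 1, k - 1) / real n)"
proof -
  have k1: "k - 1 < k" using k by simp
  have "(X n *\<^sub>v local_par k \<beta> g' n) $ i - (X n *\<^sub>v local_par k \<beta> g n) $ i
    = X n $$ (i, k - 1) * ((g' - g) / sqrt (real n))" if i: "i < n" for i
  proof -
    have "(X n *\<^sub>v local_par k \<beta> g' n) $ i - (X n *\<^sub>v local_par k \<beta> g n) $ i
      = (\<Sum>j<k. X n $$ (i, j) * (local_par k \<beta> g' n $ j - local_par k \<beta> g n $ j))"
      unfolding mat_vec_index[OF A local_par_carrier[OF b] i]
      by (simp add: sum_subtractf right_diff_distrib)
    also have "\<dots> = (\<Sum>j\<in>{k - 1}. X n $$ (i, j) * (local_par k \<beta> g' n $ j - local_par k \<beta> g n $ j))"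
      by (intro sum.mono_neutral_right) (use k in \<open>auto simp: local_par_index[OF b]\<close>)
    also have "\<dots> = X n $$ (i, k - 1) * ((g' - g) / sqrt (real n))"
      using k1 by (simp add: local_par_index[OF b] diff_divide_distrib)
    finally show ?thesis .
  qed
  then have "(\<Sum>i<n. ((X n *\<^sub>v local_par k \<beta> g' n) $ i - (X n *\<^sub>v local_par k \<beta> g n) $ i)\<^sup>2)
    = (\<Sum>i<n. (X n $$ (i, k - 1) * ((g' - g) / sqrt (real n)))\<^sup>2)"
    by (intro sum.cong refl) simp
  also have "\<dots> = (\<Sum>i<n. X n $$ (i, k - 1) * X n $$ (i, k - 1)) * ((g' - g)\<^sup>2 / real n)"
    using n by (simp add: power_mult_distrib power_divide sum_distrib_right sum_divide_distrib power2_eq_square[of "X n $$ _"])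
  finally show ?thesis unfolding gram_index[OF A k1 k1] by simp
qed

definition admissible_design :: "nat \<Rightarrow> real mat \<Rightarrow> (nat \<Rightarrow> real mat) \<Rightarrow> real vec \<Rightarrow> bool" where
  "admissible_design k Q X \<beta> \<longleftrightarrow> (\<forall>n. X n \<in> carrier_mat n k)
    \<and> (\<forall>i<k. \<forall>j<k. (\<lambda>n. (transpose_mat (X n) * X n) $$ (i, j) / real n) \<longlonglongrightarrow> Q $$ (i, j))
    \<and> \<beta> \<in> carrier_vec k \<and> \<beta> $ (k - 1) = 0"

text \<open>Fixes exactly what the constants of the theorem may depend on; X and \<beta> remain
  quantified inside the results.\<close>

locale limit_design =
  fixes k :: nat and \<sigma> \<alpha> :: real and Q :: "real mat" and t :: "real vec"
  assumes k: "1 < k" and sigma: "0 < \<sigma>" and alpha: "0 < \<alpha>"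
    and Q: "Q \<in> carrier_mat k k" "pos_def_mat Q" and Q12: "\<forall>j<k - 1. Q $$ (j, k - 1) = 0"
begin

abbreviation "q \<equiv> Q $$ (k - 1, k - 1)"
abbreviation "limit_cut \<equiv> local_cut (exp (-2 * \<alpha>)) (\<alpha> * q / \<sigma>\<^sup>2) (t $ (k - 1))"
abbreviation "R \<equiv> adj_inv Q"
abbreviation "F X \<beta> n g \<equiv> Fdist X k (k - 1) \<sigma> \<alpha> t n (local_par k \<beta> g n)"

section \<open>The limiting inverse and a gap uniform over designs\<close>

lemma det_Q: "det Q \<noteq> 0" by (rule pos_def_det_nz[OF Q])

lemma R_pos: "j < k \<Longrightarrow> 0 < R $$ (j, j)"
  using adj_inv[OF Q(1) det_Q] by (intro pos_def_inv_diag_pos[OF Q])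

lemma R_last: "j < k \<Longrightarrow> R $$ (j, k - 1) * q = (if j = k - 1 then 1 else 0)"
  using adj_inv[OF Q(1) det_Q] k Q12 by (intro inv_last_col[OF Q(1)]) auto

lemma R_last_diag: "R $$ (k - 1, k - 1) * q = 1"
  using R_last[of "k - 1"] k by simp

lemma q_pos: "0 < q"
proof (rule zero_less_mult_pos)
  show "0 < R $$ (k - 1, k - 1) * q" unfolding R_last_diag by simp
  show "0 < R $$ (k - 1, k - 1)" using k by (intro R_pos) simp
qed

lemma R_off: "j < k - 1 \<Longrightarrow> R $$ (j, k - 1) = 0"
  using R_last[of j] q_pos by simp

lemma limit_rate_pos: "0 < \<alpha> * q / \<sigma>\<^sup>2"
  using alpha q_pos sigma by simp

text \<open>Every inequality needed for the window and gap bounds is strict at the limit, and the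
  limits depend on Q but not on the design. So \<kappa> can be chosen first, and the inequalities
  hold for all large n.\<close>

lemma Fdist_gap_less:
  assumes gg: "limit_cut g < limit_cut g'"
  shows "\<exists>\<kappa>>0. \<forall>X \<beta>. admissible_design k Q X \<beta> \<longrightarrow>
    (\<forall>\<^sub>F n in sequentially. F X \<beta> n g + \<kappa> \<le> F X \<beta> n g')"
proof -
  define c where "c = exp (-2 * \<alpha>)"
  define a0 where "a0 = \<alpha> * q / \<sigma>\<^sup>2"
  have c: "0 < c" by (simp add: c_def)
  have a0: "0 < a0" unfolding a0_def by (rule limit_rate_pos)
  have k1: "k - 1 < k" using k by simp
  define x where "x = limit_cut g"
  define x' where "x' = limit_cut g'"
  have xx: "x < x'" using gg by (simp add: x_def x'_def)
  \<comment> \<open>The window is the middle third between the limiting cuts; the margins let both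
    cut conditions survive when the limiting rate is replaced by the one at n.\<close>
  define e1 where "e1 = (2 * x + x') / 3"
  define e2 where "e2 = (x + 2 * x') / 3"
  have e: "x < e1" "e1 < e2" "e2 < x'" using xx by (auto simp: e1_def e2_def)
  define m where "m = max \<bar>e1\<bar> \<bar>e2\<bar>"
  define r where "r = R $$ (k - 1, k - 1)"
  have r: "0 < r" unfolding r_def by (rule R_pos[OF k1])
  \<comment> \<open>Valid for the window as long as n H_kk stays between r / 2 and 2 r, where r is
    its limit.\<close>
  define p where "p = (e2 - e1) * (exp (- m\<^sup>2 / (2 * \<sigma>\<^sup>2 * (r / 2))) / sqrt (2 * pi * \<sigma>\<^sup>2 * (2 * r)))"
  have p: "0 < p" using e r sigma by (simp add: p_def)
  have "((\<lambda>M. \<Sum>j<k - 1. \<sigma>\<^sup>2 * R $$ (j, j) / (t $ j + M)\<^sup>2) \<longlongrightarrow> (\<Sum>j<k - 1. 0)) at_top"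
    by (intro tendsto_sum tendsto_divide_0[OF tendsto_const] filterlim_at_top_imp_at_infinity
        filterlim_pow_at_top filterlim_tendsto_add_at_top[OF tendsto_const] filterlim_ident) simp
  then have ev1: "\<forall>\<^sub>F M in at_top. (\<Sum>j<k - 1. \<sigma>\<^sup>2 * R $$ (j, j) / (t $ j + M)\<^sup>2) < p / 2"
    using p by (intro order_tendstoD(2)[where y = 0]) auto
  have ev2: "\<forall>\<^sub>F M in at_top. \<forall>j\<in>{..<k - 1}. 0 < t $ j + M"
  proof (rule eventually_ball_finite)
    show "\<forall>j\<in>{..<k - 1}. \<forall>\<^sub>F M in at_top. 0 < t $ j + M"
    proof
      fix j
      show "\<forall>\<^sub>F M in at_top. 0 < t $ j + M"
        using eventually_gt_at_top[of "- t $ j"] by eventually_elim linarith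
    qed
  qed simp
  obtain M where M: "(\<Sum>j<k - 1. \<sigma>\<^sup>2 * R $$ (j, j) / (t $ j + M)\<^sup>2) < p / 2" "\<And>j. j < k - 1 \<Longrightarrow> 0 < t $ j + M"
    using eventually_happens'[OF trivial_limit_at_top_linorder eventually_conj[OF ev1 ev2]] by auto
  \<comment> \<open>The absolute value and the added 1 make S positive and strictly larger than the
    limit of the exponent it must dominate.\<close>
  define S where "S = M\<^sup>2 * \<bar>\<Sum>l<k - 1. \<Sum>m<k - 1. Q $$ (l, m)\<bar> / \<sigma>\<^sup>2 + 1"
  have S: "0 < S" by (simp add: S_def add_nonneg_pos)
  \<comment> \<open>Half of the lower bound for the window set; the other half absorbs the strips of
    \<open>Fdist_gap\<close>.\<close>
  define \<kappa> where "\<kappa> = (p / (2 * (1 + sqrt (exp S - 1))))\<^sup>2 / 2"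
  have "0 < 1 + sqrt (exp S - 1)" using S by (simp add: add_pos_nonneg)
  then have \<kappa>: "0 < \<kappa>" using p by (simp add: \<kappa>_def)
  have "\<forall>\<^sub>F n in sequentially. F X \<beta> n g + \<kappa> \<le> F X \<beta> n g'" if adm: "admissible_design k Q X \<beta>" for X \<beta>
  proof -
    from adm have X: "\<And>n. X n \<in> carrier_mat n k"
      and lim: "\<And>i j. i < k \<Longrightarrow> j < k \<Longrightarrow> (\<lambda>n. (transpose_mat (X n) * X n) $$ (i, j) / real n) \<longlonglongrightarrow> Q $$ (i, j)"
      and b: "\<beta> \<in> carrier_vec k" "\<beta> $ (k - 1) = 0"
      by (auto simp: admissible_design_def)
    obtain H where H: "\<forall>\<^sub>F n in sequentially. H n \<in> carrier_mat k k \<and> transpose_mat (X n) * X n * H n = 1\<^sub>m k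
      \<and> H n * (transpose_mat (X n) * X n) = 1\<^sub>m k"
      and Hlim: "\<And>i j. i < k \<Longrightarrow> j < k \<Longrightarrow> (\<lambda>n. real n * H n $$ (i, j)) \<longlonglongrightarrow> R $$ (i, j)"
      by (rule gram_inv_eventually[OF X Q(1) det_Q]) (rule lim, assumption+, rule that)
    define rate where "rate n = \<alpha> / (\<sigma>\<^sup>2 * (real n * H n $$ (k - 1, k - 1)))" for n
    define rat where "rat n j = H n $$ (j, k - 1) / H n $$ (k - 1, k - 1)" for n j
    \<comment> \<open>The sum bounds the corrections of all coordinates at once. The absolute value
      of the rate keeps the bound non-negative for every n.\<close>
    define \<epsilon> where "\<epsilon> n = (\<Sum>j<k - 1. \<bar>rat n j\<bar>) * ((1 + 1 / \<bar>rate n\<bar>) / c)" for n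
    have Hk: "(\<lambda>n. real n * H n $$ (k - 1, k - 1)) \<longlonglongrightarrow> r" unfolding r_def by (rule Hlim[OF k1 k1])
    have "rate \<longlonglongrightarrow> \<alpha> / (\<sigma>\<^sup>2 * r)"
      unfolding rate_def[abs_def] using r sigma by (intro tendsto_intros Hk) auto
    moreover have "\<alpha> / (\<sigma>\<^sup>2 * r) = a0"
      using R_last_diag r sigma by (simp add: r_def a0_def field_simps)
    ultimately have rate: "rate \<longlonglongrightarrow> a0" by simp
    have rat: "(\<lambda>n. rat n j) \<longlonglongrightarrow> 0" if j: "j < k - 1" for j
    proof -
      have "(\<lambda>n. (real n * H n $$ (j, k - 1)) / (real n * H n $$ (k - 1, k - 1))) \<longlonglongrightarrow> R $$ (j, k - 1) / r"
        using r j k1 by (intro tendsto_divide Hk Hlim) auto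
      moreover have "\<forall>\<^sub>F n in sequentially. (real n * H n $$ (j, k - 1)) / (real n * H n $$ (k - 1, k - 1)) = rat n j"
        using eventually_gt_at_top[of 0] by eventually_elim (simp add: rat_def)
      ultimately show ?thesis using R_off[OF j] by (simp add: tendsto_cong)
    qed
    have eps: "\<epsilon> \<longlonglongrightarrow> 0"
    proof -
      have "(\<lambda>n. (\<Sum>j<k - 1. \<bar>rat n j\<bar>) * ((1 + 1 / \<bar>rate n\<bar>) / c)) \<longlonglongrightarrow> (\<Sum>j<k - 1. \<bar>0\<bar>) * ((1 + 1 / \<bar>a0\<bar>) / c)"
        using a0 c by (intro tendsto_intros rate rat) auto
      then show ?thesis by (simp add: \<epsilon>_def[abs_def])
    qed
    have evH: "\<forall>\<^sub>F n in sequentially. \<forall>j\<in>{..<k}. 0 < real n * H n $$ (j, j)"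
      by (rule eventually_ball_finite) (use order_tendstoD(1)[OF Hlim R_pos] in auto)
    have evv: "\<forall>\<^sub>F n in sequentially. r / 2 < real n * H n $$ (k - 1, k - 1)"
      "\<forall>\<^sub>F n in sequentially. real n * H n $$ (k - 1, k - 1) < 2 * r"
      by (rule order_tendstoD[OF Hk], use r in simp)+
    have "(\<lambda>n. \<Sum>j<k - 1. \<sigma>\<^sup>2 * (real n * H n $$ (j, j)) / (t $ j + M)\<^sup>2) \<longlonglongrightarrow> (\<Sum>j<k - 1. \<sigma>\<^sup>2 * R $$ (j, j) / (t $ j + M)\<^sup>2)"
      using M(2) by (intro tendsto_intros Hlim) force+
    from order_tendstoD(2)[OF this M(1)]
    have evM: "\<forall>\<^sub>F n in sequentially. (\<Sum>j<k - 1. \<sigma>\<^sup>2 * (real n * H n $$ (j, j)) / (t $ j + M)\<^sup>2) < p / 2" .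
    have "(\<lambda>n. M\<^sup>2 * (\<Sum>l<k - 1. \<Sum>m<k - 1. (transpose_mat (X n) * X n) $$ (l, m) / real n) / \<sigma>\<^sup>2)
      \<longlonglongrightarrow> M\<^sup>2 * (\<Sum>l<k - 1. \<Sum>m<k - 1. Q $$ (l, m)) / \<sigma>\<^sup>2"
      using sigma by (intro tendsto_mult tendsto_divide tendsto_sum tendsto_const lim) auto
    moreover have "M\<^sup>2 * (\<Sum>l<k - 1. \<Sum>m<k - 1. Q $$ (l, m)) / \<sigma>\<^sup>2 < S"
    proof -
      have "M\<^sup>2 * (\<Sum>l<k - 1. \<Sum>m<k - 1. Q $$ (l, m)) / \<sigma>\<^sup>2 \<le> M\<^sup>2 * \<bar>\<Sum>l<k - 1. \<Sum>m<k - 1. Q $$ (l, m)\<bar> / \<sigma>\<^sup>2"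
        by (intro divide_right_mono mult_left_mono) auto
      then show ?thesis by (simp add: S_def)
    qed
    ultimately have evS: "\<forall>\<^sub>F n in sequentially. M\<^sup>2 * (\<Sum>l<k - 1. \<Sum>m<k - 1. (transpose_mat (X n) * X n) $$ (l, m) / real n) / \<sigma>\<^sup>2 < S"
      by (rule order_tendstoD(2))
    have "shrink c a0 (x + g) = t $ (k - 1) + g" "shrink c a0 (x' + g') = t $ (k - 1) + g'"
      unfolding x_def x'_def c_def a0_def by (rule shrink_local_cut; use c a0 in \<open>simp add: c_def a0_def\<close>)+
    then have "t $ (k - 1) + g < shrink c a0 (e1 + g)" "shrink c a0 (e2 + g') < t $ (k - 1) + g'"
      using shrink_strict_mono[OF c a0, of "x + g" "e1 + g"] shrink_strict_mono[OF c a0, of "e2 + g'" "x' + g'"] e by auto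
    then have evc: "\<forall>\<^sub>F n in sequentially. t $ (k - 1) + g < shrink c (rate n) (e1 + g)"
      "\<forall>\<^sub>F n in sequentially. shrink c (rate n) (e2 + g') < t $ (k - 1) + g'"
      using order_tendstoD[OF tendsto_shrink[OF c rate]] by blast+
    have "(\<lambda>n. \<Sum>j<k - 1. 2 * \<epsilon> n / (\<sigma> * sqrt (real n * H n $$ (j, j)))) \<longlonglongrightarrow> (\<Sum>j<k - 1. 2 * 0 / (\<sigma> * sqrt (R $$ (j, j))))"
    proof (intro tendsto_sum tendsto_divide tendsto_mult tendsto_const eps tendsto_real_sqrt Hlim)
      show "\<sigma> * sqrt (R $$ (j, j)) \<noteq> 0" if "j \<in> {..<k - 1}" for j
      proof -
        have "j < k" using that by simp
        then show ?thesis using sigma R_pos[of j] by simp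
      qed
    qed auto
    then have evN: "\<forall>\<^sub>F n in sequentially. (\<Sum>j<k - 1. 2 * \<epsilon> n / (\<sigma> * sqrt (real n * H n $$ (j, j)))) < \<kappa>"
      using \<kappa> by (intro order_tendstoD(2)[where y = 0]) auto
    show ?thesis
      using H evH evv evM evS evc evN eventually_gt_at_top[of 0]
    proof eventually_elim
      case (elim n)
      then have n: "0 < n" by simp
      interpret design_matrix X n k "H n"
        using elim(1,2) k X by unfold_locales (auto simp: zero_less_mult_iff)
      have Hk': "0 < real n * H n $$ (k - 1, k - 1)" using n Hpos by simp
      have rpos: "0 < rate n" using alpha sigma Hk' by (simp add: rate_def)
      have "p \<le> measure (P0 \<sigma>) {y \<in> space (P0 \<sigma>). e1 < U (k - 1) y \<and> U (k - 1) y \<le> e2}"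
        unfolding p_def
        by (rule gauss_linear_window[OF sigma]) (use elim(3,4) e r in \<open>auto simp: U_variance[OF k1] m_def\<close>)
      from window_lower[OF n sigma M(2) less_imp_le[OF p] this less_imp_le[OF elim(5)] less_imp_le[OF elim(6)]]
      have B: "2 * \<kappa> \<le> measure (P0 \<sigma>) {y \<in> space (P0 \<sigma>). (\<forall>j<k - 1. U j y \<le> t $ j) \<and> e1 < U (k - 1) y \<and> U (k - 1) y \<le> e2}"
        unfolding \<kappa>_def by simp
      have c1: "t $ (k - 1) + g < shrink (exp (- 2 * \<alpha>)) (\<alpha> / (\<sigma>\<^sup>2 * (real n * H n $$ (k - 1, k - 1)))) (e1 + g)"
        and c2: "shrink (exp (- 2 * \<alpha>)) (\<alpha> / (\<sigma>\<^sup>2 * (real n * H n $$ (k - 1, k - 1)))) (e2 + g') \<le> t $ (k - 1) + g'"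
        using elim(7) less_imp_le[OF elim(8)] unfolding c_def rate_def .
      have rat_le: "\<bar>rat n j\<bar> * ((1 + 1 / rate n) / c) \<le> \<epsilon> n" if "j < k - 1" for j
      proof -
        have "\<bar>rat n j\<bar> \<le> (\<Sum>j<k - 1. \<bar>rat n j\<bar>)"
          using that by (intro member_le_sum) auto
        then have "\<bar>rat n j\<bar> * ((1 + 1 / rate n) / c) \<le> (\<Sum>j<k - 1. \<bar>rat n j\<bar>) * ((1 + 1 / rate n) / c)"
          using rpos c by (intro mult_right_mono) auto
        then show ?thesis unfolding \<epsilon>_def abs_of_pos[OF rpos] .
      qed
      have eps0: "0 \<le> \<epsilon> n"
        unfolding \<epsilon>_def using c by (intro mult_nonneg_nonneg sum_nonneg divide_nonneg_nonneg add_nonneg_nonneg) auto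
      note Fdist_gap[OF n sigma alpha b less_imp_le[OF e(2)] c1 c2 rat_le[unfolded rat_def rate_def c_def] eps0]
      then show ?case using B elim(9) by linarith
    qed
  qed
  with \<kappa> show ?thesis by blast
qed

lemma Fdist_gap_ne:
  assumes "limit_cut g \<noteq> limit_cut g'"
  shows "\<exists>\<kappa>>0. \<forall>X \<beta>. admissible_design k Q X \<beta> \<longrightarrow>
    (\<forall>\<^sub>F n in sequentially. \<kappa> \<le> \<bar>F X \<beta> n g' - F X \<beta> n g\<bar>)"
proof -
  have *: "\<exists>\<kappa>>0. \<forall>X \<beta>. admissible_design k Q X \<beta> \<longrightarrow>
    (\<forall>\<^sub>F n in sequentially. \<kappa> \<le> \<bar>F X \<beta> n v - F X \<beta> n u\<bar>)" if uv: "limit_cut u < limit_cut v" for u v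
  proof -
    obtain \<kappa> where \<kappa>: "0 < \<kappa>" "\<And>X \<beta>. admissible_design k Q X \<beta> \<Longrightarrow>
      \<forall>\<^sub>F n in sequentially. F X \<beta> n u + \<kappa> \<le> F X \<beta> n v"
      using Fdist_gap_less[OF uv] by blast
    have "\<forall>\<^sub>F n in sequentially. \<kappa> \<le> \<bar>F X \<beta> n v - F X \<beta> n u\<bar>" if "admissible_design k Q X \<beta>" for X \<beta>
      using \<kappa>(2)[OF that] by eventually_elim linarith
    with \<kappa>(1) show ?thesis by blast
  qed
  show ?thesis
  proof (cases "limit_cut g < limit_cut g'")
    case False
    then show ?thesis using *[of g' g] assms by (simp add: abs_minus_commute)
  qed (rule *)
qed

text \<open>A fixed \<tau> strictly above the limiting root dominates it for all large n. The
  quantifier over h stands inside the eventuality because the infimum over estimators is taken at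
  each n.\<close>

lemma err_prob_pair:
  assumes adm: "admissible_design k Q X \<beta>"
    and gap: "\<forall>\<^sub>F n in sequentially. \<kappa> \<le> \<bar>F X \<beta> n g' - F X \<beta> n g\<bar>" and d: "2 * \<delta> < \<kappa>"
    and T: "sqrt (exp ((g' - g)\<^sup>2 * q / \<sigma>\<^sup>2) - 1) < \<tau>"
  shows "\<forall>\<^sub>F n in sequentially. \<forall>h\<in>estimators n.
    1 \<le> err_prob X k (k - 1) \<sigma> \<alpha> t n (local_par k \<beta> g' n) h \<delta>
      + err_prob X k (k - 1) \<sigma> \<alpha> t n (local_par k \<beta> g n) h \<delta>
      + \<tau> * sqrt (err_prob X k (k - 1) \<sigma> \<alpha> t n (local_par k \<beta> g n) h \<delta>)"
proof -
  have k1: "k - 1 < k" "0 < k" using k by auto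
  from adm have X: "\<And>n. X n \<in> carrier_mat n k"
    and lim: "\<And>i j. i < k \<Longrightarrow> j < k \<Longrightarrow> (\<lambda>n. (transpose_mat (X n) * X n) $$ (i, j) / real n) \<longlonglongrightarrow> Q $$ (i, j)"
    and b: "\<beta> \<in> carrier_vec k"
    by (auto simp: admissible_design_def)
  have "(\<lambda>n. sqrt (exp ((g' - g)\<^sup>2 * ((transpose_mat (X n) * X n) $$ (k - 1, k - 1) / real n) / \<sigma>\<^sup>2) - 1))
    \<longlonglongrightarrow> sqrt (exp ((g' - g)\<^sup>2 * q / \<sigma>\<^sup>2) - 1)"
    using sigma by (intro tendsto_real_sqrt tendsto_diff tendsto_exp tendsto_divide tendsto_mult tendsto_const lim k1) auto
  from order_tendstoD(2)[OF this T] gap eventually_gt_at_top[of 0]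
  show ?thesis
  proof eventually_elim
    case (elim n)
    show ?case
    proof
      fix h assume h: "h \<in> estimators n"
      have "2 * \<delta> < \<bar>F X \<beta> n g' - F X \<beta> n g\<bar>" using elim d by linarith
      from err_prob_two_point[OF sigma h this] local_par_mean_dist[where X = X, OF X b elim(3) k1(2)]
      have "1 \<le> err_prob X k (k - 1) \<sigma> \<alpha> t n (local_par k \<beta> g' n) h \<delta>
        + err_prob X k (k - 1) \<sigma> \<alpha> t n (local_par k \<beta> g n) h \<delta>
        + sqrt (exp ((g' - g)\<^sup>2 * ((transpose_mat (X n) * X n) $$ (k - 1, k - 1) / real n) / \<sigma>\<^sup>2) - 1)
          * sqrt (err_prob X k (k - 1) \<sigma> \<alpha> t n (local_par k \<beta> g n) h \<delta>)"
        by simp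
      also have "\<dots> \<le> err_prob X k (k - 1) \<sigma> \<alpha> t n (local_par k \<beta> g' n) h \<delta>
        + err_prob X k (k - 1) \<sigma> \<alpha> t n (local_par k \<beta> g n) h \<delta>
        + \<tau> * sqrt (err_prob X k (k - 1) \<sigma> \<alpha> t n (local_par k \<beta> g n) h \<delta>)"
        using elim(1) by (intro add_left_mono mult_right_mono) (auto simp: err_prob_nonneg)
      finally show "1 \<le> err_prob X k (k - 1) \<sigma> \<alpha> t n (local_par k \<beta> g' n) h \<delta>
        + err_prob X k (k - 1) \<sigma> \<alpha> t n (local_par k \<beta> g n) h \<delta>
        + \<tau> * sqrt (err_prob X k (k - 1) \<sigma> \<alpha> t n (local_par k \<beta> g n) h \<delta>)" .
    qed
  qed
qed

text \<open>Premise L isolates the elementary passage from the two-point inequality to a bound on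
  the larger error. It is used once with \<tau> of fixed size and once with \<tau> arbitrarily
  small.\<close>

lemma minimax_lower:
  assumes adm: "admissible_design k Q X \<beta>"
    and gap: "\<forall>\<^sub>F n in sequentially. \<kappa> \<le> \<bar>F X \<beta> n g' - F X \<beta> n g\<bar>" and d: "2 * \<delta> < \<kappa>"
    and T: "sqrt (exp ((g' - g)\<^sup>2 * q / \<sigma>\<^sup>2) - 1) < \<tau>"
    and \<rho>: "\<bar>g\<bar> < \<rho>" "\<bar>g'\<bar> < \<rho>"
    and L: "\<And>x y. 0 \<le> x \<Longrightarrow> x \<le> 1 \<Longrightarrow> 1 \<le> y + x + \<tau> * sqrt x \<Longrightarrow> L \<le> max x y"
  shows "ereal L \<le> liminf (\<lambda>n. INF h\<in>estimators n. SUP \<theta>\<in>nbhd k \<beta> \<rho> n.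
            ereal (err_prob X k (k - 1) \<sigma> \<alpha> t n \<theta> h \<delta>))"
proof (rule Liminf_bounded)
  have b: "\<beta> \<in> carrier_vec k" using adm by (simp add: admissible_design_def)
  show "\<forall>\<^sub>F n in sequentially. ereal L \<le> (INF h\<in>estimators n. SUP \<theta>\<in>nbhd k \<beta> \<rho> n.
            ereal (err_prob X k (k - 1) \<sigma> \<alpha> t n \<theta> h \<delta>))"
    using err_prob_pair[OF adm gap d T] eventually_gt_at_top[of 0]
  proof eventually_elim
    case (elim n)
    show ?case
    proof (rule INF_greatest)
      fix h assume h: "h \<in> estimators n"
      define err where "err \<theta> = err_prob X k (k - 1) \<sigma> \<alpha> t n \<theta> h \<delta>" for \<theta>
      have nb: "local_par k \<beta> g n \<in> nbhd k \<beta> \<rho> n" "local_par k \<beta> g' n \<in> nbhd k \<beta> \<rho> n"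
        using elim(2) \<rho> k by (auto intro!: local_par_nbhd[OF b])
      have "L \<le> max (err (local_par k \<beta> g n)) (err (local_par k \<beta> g' n))"
        unfolding err_def using elim(1) h by (intro L err_prob_nonneg err_prob_le_1[OF sigma]) auto
      then have "ereal L \<le> max (ereal (err (local_par k \<beta> g n))) (ereal (err (local_par k \<beta> g' n)))"
        by (simp add: max_def split: if_splits)
      also have "\<dots> \<le> (SUP \<theta>\<in>nbhd k \<beta> \<rho> n. ereal (err \<theta>))"
        using nb by (intro max.boundedI SUP_upper)
      finally show "ereal L \<le> (SUP \<theta>\<in>nbhd k \<beta> \<rho> n. ereal (err_prob X k (k - 1) \<sigma> \<alpha> t n \<theta> h \<delta>))"
        unfolding err_def .
    qed
  qed
qed

text \<open>At g = 0 the parameter is \<beta> itself, where consistency sends the error to 0. In the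
  two-point inequality \<tau> multiplies the root of this error, so its size does not matter and the
  error at g' is forced to 1.\<close>

lemma sup_err_tendsto_1:
  assumes adm: "admissible_design k Q X \<beta>"
    and gap: "\<forall>\<^sub>F n in sequentially. \<kappa> \<le> \<bar>F X \<beta> n g' - F X \<beta> n 0\<bar>" and d: "2 * \<delta> < \<kappa>"
    and \<rho>: "\<bar>g'\<bar> < \<rho>" and est: "\<And>n. Fh n \<in> estimators n"
    and cons: "(\<lambda>n. err_prob X k (k - 1) \<sigma> \<alpha> t n \<beta> (Fh n) \<delta>) \<longlonglongrightarrow> 0"
  shows "(\<lambda>n. SUP \<theta>\<in>nbhd k \<beta> \<rho> n. ereal (err_prob X k (k - 1) \<sigma> \<alpha> t n \<theta> (Fh n) \<delta>)) \<longlonglongrightarrow> 1"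
proof -
  have b: "\<beta> \<in> carrier_vec k" using adm by (simp add: admissible_design_def)
  define \<tau> where "\<tau> = sqrt (exp ((g' - 0)\<^sup>2 * q / \<sigma>\<^sup>2) - 1) + 1"
  define err where "err n \<theta> = err_prob X k (k - 1) \<sigma> \<alpha> t n \<theta> (Fh n) \<delta>" for n \<theta>
  have "(\<lambda>n. 1 - err n \<beta> - \<tau> * sqrt (err n \<beta>)) \<longlonglongrightarrow> 1 - 0 - \<tau> * sqrt 0"
    unfolding err_def by (intro tendsto_intros cons)
  then have low: "(\<lambda>n. ereal (1 - err n \<beta> - \<tau> * sqrt (err n \<beta>))) \<longlonglongrightarrow> 1"
    by (simp add: one_ereal_def)
  have pair: "\<forall>\<^sub>F n in sequentially. \<forall>h\<in>estimators n.
    1 \<le> err_prob X k (k - 1) \<sigma> \<alpha> t n (local_par k \<beta> g' n) h \<delta>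
      + err_prob X k (k - 1) \<sigma> \<alpha> t n (local_par k \<beta> 0 n) h \<delta>
      + \<tau> * sqrt (err_prob X k (k - 1) \<sigma> \<alpha> t n (local_par k \<beta> 0 n) h \<delta>)"
    by (rule err_prob_pair[OF adm gap d]) (simp add: \<tau>_def)
  show ?thesis
    unfolding err_def[symmetric]
  proof (rule tendsto_sandwich[OF _ _ low tendsto_const])
    show "\<forall>\<^sub>F n in sequentially. ereal (1 - err n \<beta> - \<tau> * sqrt (err n \<beta>)) \<le> (SUP \<theta>\<in>nbhd k \<beta> \<rho> n. ereal (err n \<theta>))"
      using pair eventually_gt_at_top[of 0]
    proof eventually_elim
      case (elim n)
      then have "1 \<le> err n (local_par k \<beta> g' n) + err n \<beta> + \<tau> * sqrt (err n \<beta>)"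
        using est[of n] unfolding local_par_0[OF b] err_def by blast
      then have "ereal (1 - err n \<beta> - \<tau> * sqrt (err n \<beta>)) \<le> ereal (err n (local_par k \<beta> g' n))"
        by simp
      also have "\<dots> \<le> (SUP \<theta>\<in>nbhd k \<beta> \<rho> n. ereal (err n \<theta>))"
        using elim(2) \<rho> k by (intro SUP_upper local_par_nbhd[OF b]) auto
      finally show ?case .
    qed
    show "\<forall>\<^sub>F n in sequentially. (SUP \<theta>\<in>nbhd k \<beta> \<rho> n. ereal (err n \<theta>)) \<le> 1"
      by (intro always_eventually allI SUP_least) (simp add: err_def err_prob_le_1[OF sigma])
  qed
qed

end

section \<open>The three claims for one choice of constants\<close>

theorem theorem13:
  fixes k :: nat and \<sigma> \<alpha> :: real and Q :: "real mat" and t :: "real vec"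
  assumes k: "k > 1"
    and sigma: "\<sigma> > 0"
    and alpha: "\<alpha> > 0"
    and Q: "Q \<in> carrier_mat k k" "pos_def_mat Q"
    and Q12: "\<forall>j < k - 1. Q $$ (j, k - 1) = 0"
    and t: "t \<in> carrier_vec k"
  shows "\<exists>\<delta>0 > 0. \<exists>\<rho>0 > 0. \<forall>X \<beta>.
     design_seq k X
     \<and> (\<forall>i<k. \<forall>j<k. ((\<lambda>n. (transpose_mat (X n) * X n) $$ (i, j) / real n) \<longlongrightarrow> Q $$ (i, j)) sequentially)
     \<and> \<beta> \<in> carrier_vec k \<and> \<beta> $ (k - 1) = 0
     \<longrightarrow>
     (\<forall>Fh :: nat \<Rightarrow> (nat \<Rightarrow> real) \<Rightarrow> real.
        (\<forall>n. Fh n \<in> estimators n)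
        \<and> (\<forall>\<delta>>0. ((\<lambda>n. err_prob X k (k - 1) \<sigma> \<alpha> t n \<beta> (Fh n) \<delta>) \<longlongrightarrow> 0) sequentially)
        \<longrightarrow> ((\<lambda>n. SUP \<theta>\<in>nbhd k \<beta> \<rho>0 n. ereal (err_prob X k (k - 1) \<sigma> \<alpha> t n \<theta> (Fh n) \<delta>0))
              \<longlongrightarrow> 1) sequentially)
     \<and> liminf (\<lambda>n. INF g\<in>estimators n. SUP \<theta>\<in>nbhd k \<beta> \<rho>0 n.
            ereal (err_prob X k (k - 1) \<sigma> \<alpha> t n \<theta> g \<delta>0)) > 0
     \<and> (SUP \<delta>\<in>{0<..}. liminf (\<lambda>n. INF g\<in>estimators n. SUP \<theta>\<in>nbhd k \<beta> \<rho>0 n.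
            ereal (err_prob X k (k - 1) \<sigma> \<alpha> t n \<theta> g \<delta>))) \<ge> 1 / 2"
proof -
  interpret limit_design k \<sigma> \<alpha> Q t
    using k sigma alpha Q Q12 by unfold_locales
  obtain gs where gs: "limit_cut gs \<noteq> limit_cut 0"
    using local_cut_nonconstant[OF exp_gt_zero limit_rate_pos] by metis
  obtain \<kappa> where \<kappa>: "0 < \<kappa>" and gap0: "\<And>X \<beta>. admissible_design k Q X \<beta> \<Longrightarrow>
      \<forall>\<^sub>F n in sequentially. \<kappa> \<le> \<bar>F X \<beta> n gs - F X \<beta> n 0\<bar>"
    using Fdist_gap_ne[OF gs[symmetric]] by blast
  define \<delta>0 where "\<delta>0 = \<kappa> / 3"
  \<comment> \<open>The open ball has to contain \<open>gs\<close> and every grid point between 0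
    and \<open>gs\<close>.\<close>
  define \<rho>0 where "\<rho>0 = \<bar>gs\<bar> + 1"
  have \<delta>0: "0 < \<delta>0" "2 * \<delta>0 < \<kappa>" using \<kappa> by (auto simp: \<delta>0_def)
  have \<rho>0: "0 < \<rho>0" "\<bar>gs\<bar> < \<rho>0" by (auto simp: \<rho>0_def)
  show ?thesis
  proof (rule exI[of _ \<delta>0], intro conjI, rule \<delta>0(1), rule exI[of _ \<rho>0], intro conjI allI impI, rule \<rho>0(1))
    fix X and \<beta> :: "real vec"
    assume "design_seq k X
     \<and> (\<forall>i<k. \<forall>j<k. ((\<lambda>n. (transpose_mat (X n) * X n) $$ (i, j) / real n) \<longlongrightarrow> Q $$ (i, j)) sequentially)
     \<and> \<beta> \<in> carrier_vec k \<and> \<beta> $ (k - 1) = 0"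
    then have adm: "admissible_design k Q X \<beta>"
      by (auto simp: admissible_design_def design_seq_def)
    note gap = gap0[OF adm]
    show "(\<lambda>n. SUP \<theta>\<in>nbhd k \<beta> \<rho>0 n. ereal (err_prob X k (k - 1) \<sigma> \<alpha> t n \<theta> (Fh n) \<delta>0)) \<longlonglongrightarrow> 1"
      if "(\<forall>n. Fh n \<in> estimators n)
        \<and> (\<forall>\<delta>>0. ((\<lambda>n. err_prob X k (k - 1) \<sigma> \<alpha> t n \<beta> (Fh n) \<delta>) \<longlongrightarrow> 0) sequentially)" for Fh
      using that \<delta>0(1) by (intro sup_err_tendsto_1[OF adm gap \<delta>0(2) \<rho>0(2)]) auto
    define \<tau> where "\<tau> = sqrt (exp ((gs - 0)\<^sup>2 * q / \<sigma>\<^sup>2) - 1) + 1"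
    have \<tau>: "0 < \<tau>" using q_pos by (auto simp: \<tau>_def intro!: add_nonneg_pos)
    \<comment> \<open>For m = max x y < 1 both x and y are at most sqrt m, so the two-point
      inequality reads 1 \<le> (2 + \<tau>) sqrt m.\<close>
    have "ereal (1 / (2 + \<tau>)\<^sup>2) \<le> liminf (\<lambda>n. INF g\<in>estimators n. SUP \<theta>\<in>nbhd k \<beta> \<rho>0 n.
            ereal (err_prob X k (k - 1) \<sigma> \<alpha> t n \<theta> g \<delta>0))"
    proof (rule minimax_lower[OF adm gap \<delta>0(2)])
      show "sqrt (exp ((gs - 0)\<^sup>2 * q / \<sigma>\<^sup>2) - 1) < \<tau>" by (simp add: \<tau>_def)
      fix x y :: real assume x: "0 \<le> x" "x \<le> 1" and y: "1 \<le> y + x + \<tau> * sqrt x"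
      define m where "m = max x y"
      show "1 / (2 + \<tau>)\<^sup>2 \<le> max x y"
      proof (cases "1 \<le> m")
        case True
        have "1 \<le> (2 + \<tau>)\<^sup>2" using \<tau> by (intro one_le_power) simp
        then have "1 / (2 + \<tau>)\<^sup>2 \<le> 1" by (simp add: divide_le_eq)
        then show ?thesis using True by (simp add: m_def)
      next
        case False
        have m0: "0 \<le> m" using x by (simp add: m_def)
        have "m \<le> sqrt m" using False m0 by (intro real_le_rsqrt) (simp add: power2_eq_square mult_left_le)
        moreover have "\<tau> * sqrt x \<le> \<tau> * sqrt m" using \<tau> by (intro mult_left_mono) (auto simp: m_def)
        moreover have "x \<le> m" "y \<le> m" by (auto simp: m_def)
        ultimately have "1 \<le> (2 + \<tau>) * sqrt m" using y unfolding distrib_right by linarith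
        then have "1 / (2 + \<tau>) \<le> sqrt m" using \<tau> by (simp add: divide_le_eq mult.commute)
        then have "(1 / (2 + \<tau>))\<^sup>2 \<le> (sqrt m)\<^sup>2" using \<tau> by (intro power_mono) auto
        then show ?thesis using m0 by (simp add: power_divide m_def)
      qed
    qed (use \<rho>0 in auto)
    moreover have "0 < ereal (1 / (2 + \<tau>)\<^sup>2)" using \<tau> by simp
    ultimately show "liminf (\<lambda>n. INF g\<in>estimators n. SUP \<theta>\<in>nbhd k \<beta> \<rho>0 n.
            ereal (err_prob X k (k - 1) \<sigma> \<alpha> t n \<theta> g \<delta>0)) > 0"
      by (rule less_le_trans[rotated])
    define V where "V = (SUP \<delta>\<in>{0<..}. liminf (\<lambda>n. INF g\<in>estimators n. SUP \<theta>\<in>nbhd k \<beta> \<rho>0 n.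
            ereal (err_prob X k (k - 1) \<sigma> \<alpha> t n \<theta> g \<delta>)))"
    have "ereal ((1 - \<epsilon>) / 2) \<le> V" if \<epsilon>: "0 < \<epsilon>" for \<epsilon>
    proof -
      \<comment> \<open>The mesh gs / m is chosen so fine that neighbouring grid points have
        chi-square root below \<epsilon>.\<close>
      have "(\<lambda>m. sqrt (exp ((gs / real m)\<^sup>2 * q / \<sigma>\<^sup>2) - 1)) \<longlonglongrightarrow> sqrt (exp (0\<^sup>2 * q / \<sigma>\<^sup>2) - 1)"
        using sigma by (intro tendsto_intros tendsto_divide_0[OF tendsto_const]
            filterlim_compose[OF filterlim_at_top_imp_at_infinity filterlim_real_sequentially] filterlim_ident) auto
      then have "\<forall>\<^sub>F m in sequentially. sqrt (exp ((gs / real m)\<^sup>2 * q / \<sigma>\<^sup>2) - 1) < \<epsilon>"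
        using \<epsilon> by (intro order_tendstoD(2)[where y = 0]) auto
      then obtain m where m: "0 < m" "sqrt (exp ((gs / real m)\<^sup>2 * q / \<sigma>\<^sup>2) - 1) < \<epsilon>"
        using eventually_happens'[OF sequentially_bot eventually_conj[OF _ eventually_gt_at_top[of 0]]] by blast
      define pt where "pt i = real i * (gs / real m)" for i
      \<comment> \<open>The cuts at the two ends of the grid differ, so they differ across some
        cell.\<close>
      have "\<exists>i<m. limit_cut (pt i) \<noteq> limit_cut (pt (Suc i))"
      proof (rule ccontr)
        assume "\<not> ?thesis"
        then have "i \<le> m \<Longrightarrow> limit_cut (pt i) = limit_cut (pt 0)" for i
          by (induction i) auto
        from this[of m] show False using gs m by (simp add: pt_def)
      qed
      then obtain i where i: "i < m" "limit_cut (pt i) \<noteq> limit_cut (pt (Suc i))" by blast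
      have pt: "\<bar>pt j\<bar> < \<rho>0" if "j \<le> m" for j
      proof -
        have "\<bar>pt j\<bar> = (real j / real m) * \<bar>gs\<bar>" by (simp add: pt_def abs_mult)
        also have "\<dots> \<le> 1 * \<bar>gs\<bar>" using that m by (intro mult_right_mono) auto
        finally show ?thesis by (simp add: \<rho>0_def)
      qed
      have "pt (Suc i) - pt i = gs / real m" by (simp add: pt_def add_divide_distrib algebra_simps)
      with m(2) have \<tau>: "sqrt (exp ((pt (Suc i) - pt i)\<^sup>2 * q / \<sigma>\<^sup>2) - 1) < \<epsilon>" by simp
      obtain \<kappa>' where \<kappa>': "0 < \<kappa>'" "\<forall>\<^sub>F n in sequentially. \<kappa>' \<le> \<bar>F X \<beta> n (pt (Suc i)) - F X \<beta> n (pt i)\<bar>"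
        using Fdist_gap_ne[OF i(2)] adm by blast
      \<comment> \<open>The threshold \<kappa>' / 3 depends on the cell and hence on \<epsilon>,
        while the radius does not; this is why the supremum over \<delta> has to stand
        outside.\<close>
      have "ereal ((1 - \<epsilon>) / 2) \<le> liminf (\<lambda>n. INF g\<in>estimators n. SUP \<theta>\<in>nbhd k \<beta> \<rho>0 n.
            ereal (err_prob X k (k - 1) \<sigma> \<alpha> t n \<theta> g (\<kappa>' / 3)))"
      proof (rule minimax_lower[OF adm \<kappa>'(2) _ \<tau>])
        fix x y :: real assume x: "0 \<le> x" "x \<le> 1" and y: "1 \<le> y + x + \<epsilon> * sqrt x"
        have "\<epsilon> * sqrt x \<le> \<epsilon> * 1" using x \<epsilon> by (intro mult_left_mono) auto
        then show "(1 - \<epsilon>) / 2 \<le> max x y" using y by (simp add: max_def)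
      qed (use \<kappa>' pt i in auto)
      also have "\<dots> \<le> V" unfolding V_def using \<kappa>' by (intro SUP_upper) simp
      finally show ?thesis .
    qed
    note bnd = this
    have "ereal (1 / 2) \<le> V"
    proof (rule ereal_le_epsilon2)
      fix e :: real assume e: "0 < e"
      have "ereal (1 / 2) = ereal ((1 - 2 * e) / 2) + ereal e"
        by (simp add: diff_divide_distrib)
      also have "\<dots> \<le> V + ereal e" using bnd[of "2 * e"] e by (intro add_right_mono) simp
      finally show "ereal (1 / 2) \<le> V + ereal e" .
    qed
    moreover have "(1 / 2 :: ereal) = ereal (1 / 2)"
      unfolding one_ereal_def numeral_eq_ereal ereal_divide by simp
    ultimately show "(SUP \<delta>\<in>{0<..}. liminf (\<lambda>n. INF g\<in>estimators n. SUP \<theta>\<in>nbhd k \<beta> \<rho>0 n.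
            ereal (err_prob X k (k - 1) \<sigma> \<alpha> t n \<theta> g \<delta>))) \<ge> 1 / 2"
      unfolding V_def by (simp only:)
  qed
qed

end
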